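(* Let $\nu\in(0,1]$ and $h,\lambda>0$. Let $\{T_n:n\geq 1\}$ be i.i.d. random variables with density $f_{\nu,h,\lambda}(t)=\lambda^h t^{\nu h-1}E_{\nu,\nu h}^h(-\lambda t^\nu)1_{(0,\infty)}(t)$, and let $$M_{\nu,h,\lambda}(t):=\sum_{n\geq 1}1_{T_1+\cdots+T_n\leq t},\qquad t\geq 0.$$ Let $I_{\nu,h,\lambda}^{(T)}(x):=\sup_{\theta\in\mathbb{R}}\{\theta x-\log\mathbb{E}[e^{\theta T_1}]\}$ for $x\in\mathbb{R}$. Then the family $\left\{\frac{M_{\nu,h,\lambda}(t)}{t}:t>0\right\}$ satisfies the large deviation principle (as $t\to\infty$, with speed $t$) with good rate function $I_{\nu,h,\lambda}^{(M)}$ defined by $$I_{\nu,h,\lambda}^{(M)}(x):=\begin{cases}xI_{\nu,h,\lambda}^{(T)}(1/x)&\text{if } x>0\\ \lambda 1_{\nu=1}&\text{if } x=0\\ \infty&\text{if } x<0.\end{cases}$$ In particular, for $\nu=1$, $$I_{1,h,\lambda}^{(M)}(x)=\begin{cases}hx\log\frac{hx}{\lambda}-hx+\lambda&\text{if } x\geq 0\\ \infty&\text{if } x<0.\end{cases}$$ For $\nu\in(0,1)$: $I_{\nu,h,\lambda}^{(M)}(x)=\infty$ for $x<0$; $I_{\nu,h,\lambda}^{(M)}$ is increasing on $[0,\infty)$; $\lim_{x\downarrow 0}I_{\nu,h,\lambda}^{(M)}(x)=I_{\nu,h,\lambda}^{(M)}(0)=0$; and $\lim_{x\to\infty}I_{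\nu,h,\lambda}^{(M)}(x)=\infty$.
   Context: Generalized Mittag-Leffler function: $E_{\alpha,\beta}^\gamma(x):=\sum_{r\geq 0}\frac{(\gamma)_r x^r}{r!\,\Gamma(\alpha r+\beta)}$, where $(\gamma)_0:=1$ and $(\gamma)_r:=\gamma(\gamma+1)\cdots(\gamma+r-1)$ for $r\geq 1$. Convention: $0\log 0=0$. It is known that $f_{\nu,h,\lambda}$ is a probability density and that, for $\nu\in(0,1)$, $\log\mathbb{E}[e^{\theta T_1}]=h\log\frac{\lambda}{\lambda+(-\theta)^\nu}$ if $\theta\leq 0$ and $=\infty$ if $\theta>0$; for $\nu=1$ (Gamma density), $\log\mathbb{E}[e^{\theta T_1}]=h\log\frac{\lambda}{\lambda-\theta}$ if $\theta<\lambda$ and $=\infty$ if $\theta\geq\lambda$. Large deviation principle (LDP): a family $\{Z_t:t>0\}$ of random variables with values in a topological space $\mathcal{Z}$ satisfies the LDP with rate function $I:\mathcal{Z}\to[0,\infty]$ if $I$ is lower semi-continuous, $\limsup_{t\to\infty}\frac{1}{t}\log P(Z_t\in C)\leq-\inf_{x\in C}I(x)$ for all closed sets $C$, and $\liminf_{t\to\infty}\frac{1}{t}\log P(Z_t\in G)\geq-\inf_{x\in G}I(x)$ for all open sets $G$. The rate function $I$ is good if all its level sets $\{x\in\mathcal{Z}:I(x)\leq\eta\}$, $\eta\geq 0$, are compact. Here $\mathcal{Z}=\mathbb{R}$. *)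

theory Defs
  imports "HOL-Probability.Probability"
begin

definition mittag_leffler3 :: "real \<Rightarrow> real \<Rightarrow> real \<Rightarrow> real \<Rightarrow> real" where
  "mittag_leffler3 \<alpha> \<beta> \<gamma> x =
     (\<Sum>r. pochhammer \<gamma> r * x ^ r / (fact r * Gamma (\<alpha> * real r + \<beta>)))"

definition waiting_density :: "real \<Rightarrow> real \<Rightarrow> real \<Rightarrow> real \<Rightarrow> real" where
  "waiting_density \<nu> h l t =
     l powr h * t powr (\<nu> * h - 1) * mittag_leffler3 \<nu> (\<nu> * h) h (- l * t powr \<nu>) * indicator {0<..} t"

text \<open>
  The coercion \<^const>\<open>ennreal\<close> truncates negative values to 0, so nonnegativity, which is part of
  what it means for a real function to be a density, has to be stated separately.
\<close>
definition has_real_density :: "'a measure \<Rightarrow> ('a \<Rightarrow> real) \<Rightarrow> (real \<Rightarrow> real) \<Rightarrow> bool" where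
  "has_real_density M X f \<longleftrightarrow>
     (AE x in lborel. 0 \<le> f x) \<and> distributed M lborel X (\<lambda>x. ennreal (f x))"

text \<open>
  The term with index \<open>n\<close> of the series is the indicator of \<open>T 1 + \<dots> + T (n + 1) \<le> t\<close>; the value
  \<open>T 0\<close> is never used. The sum is taken in the extended nonnegative reals, since it may be infinite
  at exceptional sample points.
\<close>
definition renewal_count :: "(nat \<Rightarrow> 'a \<Rightarrow> real) \<Rightarrow> real \<Rightarrow> 'a \<Rightarrow> ennreal" where
  "renewal_count T t \<omega> = (\<Sum>n. indicator {..t} (\<Sum>k = 1..Suc n. T k \<omega>))"

definition elog :: "ennreal \<Rightarrow> ereal" where
  "elog x = (if x = 0 then - \<infinity> else if x = \<infinity> then \<infinity> else ereal (ln (enn2real x)))"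

definition log_mgf :: "'a measure \<Rightarrow> ('a \<Rightarrow> real) \<Rightarrow> real \<Rightarrow> ereal" where
  "log_mgf M X \<theta> = elog (\<integral>\<^sup>+ \<omega>. ennreal (exp (\<theta> * X \<omega>)) \<partial>M)"

definition cramer_rate :: "'a measure \<Rightarrow> ('a \<Rightarrow> real) \<Rightarrow> real \<Rightarrow> ereal" where
  "cramer_rate M X x = (SUP \<theta>::real. ereal (\<theta> * x) - log_mgf M X \<theta>)"

definition renewal_rate :: "real \<Rightarrow> real \<Rightarrow> (real \<Rightarrow> ereal) \<Rightarrow> real \<Rightarrow> ereal" where
  "renewal_rate \<nu> l I_T x =
     (if x > 0 then ereal x * I_T (1 / x)
      else if x = 0 then (if \<nu> = 1 then ereal l else 0)
      else \<infinity>)"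

definition lower_semicontinuous :: "('b::topological_space \<Rightarrow> ereal) \<Rightarrow> bool" where
  "lower_semicontinuous I \<longleftrightarrow> (\<forall>a. closed {x. I x \<le> a})"

definition satisfies_LDP ::
  "'a measure \<Rightarrow> (real \<Rightarrow> 'a \<Rightarrow> 'b::topological_space) \<Rightarrow> ('b \<Rightarrow> ereal) \<Rightarrow> bool" where
  "satisfies_LDP M Z I \<longleftrightarrow>
     (\<forall>t>0. Z t \<in> borel_measurable M) \<and>
     (\<forall>x. 0 \<le> I x) \<and>
     lower_semicontinuous I \<and>
     (\<forall>C. closed C \<longrightarrow>
        Limsup at_top (\<lambda>t. ereal (1 / t) * elog (emeasure M {\<omega> \<in> space M. Z t \<omega> \<in> C}))
          \<le> - (INF x\<in>C. I x)) \<and>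
     (\<forall>G. open G \<longrightarrow>
        Liminf at_top (\<lambda>t. ereal (1 / t) * elog (emeasure M {\<omega> \<in> space M. Z t \<omega> \<in> G}))
          \<ge> - (INF x\<in>G. I x))"

definition good_rate :: "('b::topological_space \<Rightarrow> ereal) \<Rightarrow> bool" where
  "good_rate I \<longleftrightarrow> (\<forall>\<eta>::real. \<eta> \<ge> 0 \<longrightarrow> compact {x. I x \<le> ereal \<eta>})"

end

theory Submission
  imports Defs "HOL-Real_Asymp.Real_Asymp" "HOL-Complex_Analysis.Complex_Analysis"
begin

text \<open>
  Put \<open>\<psi> s = - ln E exp (- s T\<^sub>1)\<close>. Integrating the Mittag-Leffler series termwise gives
  \<open>\<psi> s = h ln (1 + s\<^sup>\<nu> / \<lambda>)\<close> for large \<open>s\<close>, and analytic continuation extends this to the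
  whole domain \<open>D\<close> of finiteness. With \<open>s = - \<theta>\<close> the rate function becomes
  \<open>I x = sup {x \<psi> s - s | s \<in> D}\<close> for all \<open>x \<ge> 0\<close>, including \<open>x = 0\<close>. The upper bounds are
  Chernoff bounds for \<open>{M t \<ge> n} = {S\<^sub>n \<le> t}\<close>. For the lower bound at \<open>x > 0\<close>, choose \<open>s\<close> with
  \<open>\<psi>' s = 1 / x\<close>: under the weight \<open>exp (- s S\<^sub>n)\<close> the mean of the summands is \<open>1 / x\<close>, so that
  \<open>M t / t\<close> concentrates at \<open>x\<close>, and the concentration is again only a Chernoff bound.
\<close>

section \<open>The Laplace transform of the waiting times\<close>

text \<open>The termwise integral converges absolutely exactly for \<open>l < s powr \<nu>\<close>,
  whereas the tilts need all of \<open>D\<close>; for \<nu> = 1 this includes negative parameters,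
  where not even finiteness of the transform is known in advance. Conversely, the supremum over all
  real \<theta> reduces to one over \<open>D\<close> only because the transform is infinite off
  \<open>D\<close>, which needs its own argument. For \<nu> < 1 the waiting time has infinite mean.
  Both cases are treated alike by splitting the line at the law-of-large-numbers value: to its right
  every parameter that gives a positive exponent is nonnegative, to its left nonpositive, and this
  is the sign that the Chernoff bound for the corresponding tail requires. For fixed
  \<open>s\<close> the exponent \<open>x * \<psi> s - s\<close> is affine in \<open>x\<close>, so
  one near-optimal parameter at the end point of a closed set that is nearest to the centre controls
  the whole set.\<close>

lemma nn_integral_powr_exp:
  fixes a s :: real
  assumes "0 < a" "0 < s"
  shows "(\<integral>\<^sup>+x. ennreal (indicator {0<..} x * x powr (a - 1) * exp (- (s * x))) \<partial>lborel)
    = ennreal (Gamma a * s powr - a)" (is "?J = _")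
proof -
  have scale: "indicator {0..} (0 + s * x) * (0 + s * x) powr (a - 1) / exp (0 + s * x)
      = s powr (a - 1) * (indicator {0<..} x * x powr (a - 1) * exp (- (s * x)))" for x
  proof (cases "0 < x")
    case True
    then show ?thesis using assms(2) by (simp add: powr_mult exp_minus divide_inverse)
  next
    case False
    then show ?thesis using assms(2) by (cases "x = 0") (auto simp: zero_le_mult_iff)
  qed
  have "ennreal (Gamma a) = (\<integral>\<^sup>+t. ennreal (indicator {0..} t * t powr (a - 1) / exp t) \<partial>lborel)"
    using assms(1) by (rule Gamma_conv_nn_integral_real)
  also have "\<dots> = ennreal \<bar>s\<bar> *
      (\<integral>\<^sup>+x. ennreal (indicator {0..} (0 + s * x) * (0 + s * x) powr (a - 1) / exp (0 + s * x)) \<partial>lborel)"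
    using assms(2) by (intro nn_integral_real_affine) auto
  also have "\<dots> = ennreal s * (ennreal (s powr (a - 1)) * ?J)"
    unfolding scale using assms(2) by (simp add: ennreal_mult' nn_integral_cmult)
  also have "\<dots> = ennreal (s * s powr (a - 1)) * ?J"
    using assms(2) by (simp add: ennreal_mult' mult.assoc)
  also have "s * s powr (a - 1) = s powr a"
    using assms(2) by (simp add: powr_diff)
  finally have "ennreal (s powr - a) * ennreal (Gamma a) = ennreal (s powr - a) * ennreal (s powr a) * ?J"
    by (simp only: mult.assoc)
  also have "ennreal (s powr - a) * ennreal (s powr a) = 1"
    using assms(2) by (simp add: ennreal_mult'[symmetric] powr_add[symmetric])
  finally show ?thesis
    by (simp add: ennreal_mult''[symmetric] mult.commute)
qed

lemma AE_pos_if_waiting_density: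
  assumes "has_real_density M X (waiting_density \<nu> h l)"
  shows "AE \<omega> in M. 0 < X \<omega>"
proof -
  have d: "distributed M lborel X (\<lambda>x. ennreal (waiting_density \<nu> h l x))"
    using assms by (simp add: has_real_density_def)
  have "0 < x" if "0 < ennreal (waiting_density \<nu> h l x)" for x
    using that by (cases "0 < x") (simp_all add: waiting_density_def)
  then have "AE x in density lborel (\<lambda>x. ennreal (waiting_density \<nu> h l x)). 0 < x"
    using AE_density[OF distributed_borel_measurable[OF d]] by blast
  then have "AE x in distr M lborel X. 0 < x"
    unfolding distributed_distr_eq_density[OF d] .
  then show ?thesis
    by (subst (asm) AE_distr_iff[OF distributed_measurable[OF d]]) (simp_all del: space_borel)
qed

text \<open>Each term of the Mittag-Leffler series contributes a Gamma integral that cancels the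
  Gamma factor in its denominator. What remains is the binomial series of
  \<open>(1 + z) powr - h\<close> with \<open>z = l * s powr - \<nu>\<close>, and the hypothesis on
  \<open>s\<close> says that \<open>z < 1\<close>.\<close>

lemma laplace_waiting_density_large:
  assumes \<nu>: "0 < \<nu>" and h: "0 < h" and l: "0 < l" and s: "0 < s" "l < s powr \<nu>"
    and X: "has_real_density M X (waiting_density \<nu> h l)"
  shows "(\<integral>\<^sup>+\<omega>. ennreal (exp (- (s * X \<omega>))) \<partial>M) = ennreal ((1 + s powr \<nu> / l) powr - h)"
proof -
  define a where "a r = \<nu> * real r + \<nu> * h" for r :: nat
  define c where "c r = l powr h * pochhammer h r * (- l) ^ r / (fact r * Gamma (a r))" for r :: nat
  define e where "e r x = indicator {0<..} x * x powr (a r - 1) * exp (- (s * x))" for r and x :: real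
  define z where "z = l * s powr - \<nu>"
  define K where "K = l powr h * s powr - (\<nu> * h)"
  have a: "0 < a r" for r using \<nu> h by (auto simp: a_def intro: add_nonneg_pos)
  have z: "0 < z" "z < 1" using s l by (auto simp: z_def powr_minus field_simps)
  have e: "has_bochner_integral lborel (e r) (Gamma (a r) * s powr - a r)" for r
    using nn_integral_powr_exp[OF a s(1), of r] a[of r] unfolding e_def
    by (intro has_bochner_integral_nn_integral) (auto simp: less_imp_le)
  have e_nonneg: "0 \<le> e r x" for r x by (simp add: e_def)
  have G: "Gamma (a r) > 0" for r using a by simp
  have poch: "0 < pochhammer h r" for r using h by (rule pochhammer_pos)
  have sa: "s powr - a r = s powr - (\<nu> * h) * (s powr - \<nu>) ^ r" for r
  proof -
    have "s powr - a r = s powr (- (\<nu> * h) + - \<nu> * real r)"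
      by (simp add: a_def algebra_simps)
    also have "\<dots> = s powr - (\<nu> * h) * s powr (- \<nu> * real r)" by (rule powr_add)
    also have "s powr (- \<nu> * real r) = (s powr - \<nu>) ^ r"
      using s(1) by (subst powr_power) (auto simp: mult.commute)
    finally show ?thesis .
  qed
  have int: "has_bochner_integral lborel (\<lambda>x. c r * e r x) (K * ((- h gchoose r) * z ^ r))" for r
  proof -
    have "c r * (Gamma (a r) * s powr - a r) = K * ((- h gchoose r) * z ^ r)"
      using G[of r] unfolding c_def sa K_def z_def gbinomial_pochhammer
      by (simp add: field_simps power_mult_distrib power_minus[of l])
    then show ?thesis
      using has_bochner_integral_mult_right[OF e[of r], of "c r"] by simp
  qed
  \<comment> \<open>The coefficient \<open>- h gchoose r\<close> has sign \<open>(- 1) ^ r\<close>,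
    so taking absolute values amounts to replacing \<open>z\<close> by \<open>- z\<close>.\<close>
  have int_norm: "has_bochner_integral lborel (\<lambda>x. norm (c r * e r x)) (K * ((- h gchoose r) * (- z) ^ r))" for r
  proof -
    have "\<bar>c r\<bar> * (Gamma (a r) * s powr - a r) = K * ((- h gchoose r) * (- z) ^ r)"
      using G[of r] l poch[of r] unfolding c_def sa K_def z_def gbinomial_pochhammer
      by (simp add: field_simps power_mult_distrib power_minus[of "_ * _"] abs_mult power_abs)
    then show ?thesis
      using has_bochner_integral_mult_right[OF e[of r], of "\<bar>c r\<bar>"] e_nonneg by (simp add: abs_mult)
  qed
  have sums: "(\<lambda>r. K * ((- h gchoose r) * z ^ r)) sums (K * (1 + z) powr - h)"
    using z by (intro sums_mult gen_binomial_real) auto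
  have norm_summable: "summable (\<lambda>r. K * ((- h gchoose r) * (- z) ^ r))"
    using z by (intro summable_mult sums_summable[OF gen_binomial_real]) auto
  have norm_nonneg: "0 \<le> K * ((- h gchoose r) * (- z) ^ r)" for r
    using int_norm[of r] Bochner_Integration.integral_nonneg[of lborel "\<lambda>x. norm (c r * e r x)"]
    by (simp add: has_bochner_integral_iff)
  \<comment> \<open>By Tonelli, almost everywhere convergence of the Mittag-Leffler series comes for free.\<close>
  have AE_summable: "AE x in lborel. summable (\<lambda>r. norm (c r * e r x))"
  proof -
    have "(\<integral>\<^sup>+x. (\<Sum>r. ennreal (norm (c r * e r x))) \<partial>lborel) = (\<Sum>r. \<integral>\<^sup>+x. ennreal (norm (c r * e r x)) \<partial>lborel)"
      by (intro nn_integral_suminf) (simp add: e_def)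
    also have "\<dots> = (\<Sum>r. ennreal (K * ((- h gchoose r) * (- z) ^ r)))"
      using int_norm
      by (intro suminf_cong, subst nn_integral_eq_integral) (auto simp: has_bochner_integral_iff)
    also have "\<dots> \<noteq> \<infinity>"
      using norm_summable norm_nonneg by (simp add: ennreal_suminf_neq_top)
    finally have "AE x in lborel. (\<Sum>r. ennreal (norm (c r * e r x))) \<noteq> \<infinity>"
      by (intro nn_integral_PInf_AE) (simp_all add: e_def)
    then show ?thesis
      by eventually_elim (intro summable_suminf_not_top, auto)
  qed
  have eq: "AE x in lborel. (\<Sum>r. c r * e r x) = waiting_density \<nu> h l x * exp (- (s * x))"
    using AE_summable
  proof eventually_elim
    case (elim x)
    show ?case
    proof (cases "0 < x")
      case True
      define k where "k = l powr h * x powr (\<nu> * h - 1) * exp (- (s * x))"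
      define u where "u r = pochhammer h r * (- l * x powr \<nu>) ^ r / (fact r * Gamma (\<nu> * real r + \<nu> * h))" for r
      have "x powr (a r - 1) = x powr (\<nu> * h - 1) * (x powr \<nu>) ^ r" for r
      proof -
        have "x powr (a r - 1) = x powr ((\<nu> * h - 1) + \<nu> * real r)" by (simp add: a_def algebra_simps)
        also have "\<dots> = x powr (\<nu> * h - 1) * x powr (\<nu> * real r)" by (rule powr_add)
        also have "x powr (\<nu> * real r) = (x powr \<nu>) ^ r"
          using True by (subst powr_power) (auto simp: mult.commute)
        finally show ?thesis .
      qed
      then have ku: "c r * e r x = k * u r" for r
        using True by (simp add: c_def e_def k_def u_def a_def power_mult_distrib power_minus[of "_ * _"] power_minus[of l])
      have "summable (\<lambda>r. k * u r)"
        using summable_norm_cancel[OF elim] by (simp add: ku)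
      \<comment> \<open>\<open>suminf\<close> says nothing about a divergent series, so the nonzero
        factor \<open>k\<close> is pulled out only once \<open>u\<close> is known to be
        summable.\<close>
      then have "summable u" using True l by (auto simp: summable_cmult_iff k_def)
      then have "(\<Sum>r. c r * e r x) = k * (\<Sum>r. u r)"
        by (simp add: ku suminf_mult)
      then show ?thesis using True
        by (simp add: k_def u_def waiting_density_def mittag_leffler3_def)
    qed (simp add: e_def waiting_density_def)
  qed
  have d: "AE x in lborel. 0 \<le> waiting_density \<nu> h l x"
    "distributed M lborel X (\<lambda>x. ennreal (waiting_density \<nu> h l x))"
    using X by (auto simp: has_real_density_def)
  have "(\<integral>\<^sup>+\<omega>. ennreal (exp (- (s * X \<omega>))) \<partial>M)
      = (\<integral>\<^sup>+x. ennreal (waiting_density \<nu> h l x) * ennreal (exp (- (s * x))) \<partial>lborel)"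
    by (rule distributed_nn_integral[OF d(2), symmetric]) simp
  also have "\<dots> = (\<integral>\<^sup>+x. ennreal (\<Sum>r. c r * e r x) \<partial>lborel)"
    using eq by (intro nn_integral_cong_AE) (auto simp: ennreal_mult''[symmetric])
  also have "\<dots> = ennreal (\<integral>x. (\<Sum>r. c r * e r x) \<partial>lborel)"
  proof (rule nn_integral_eq_integral)
    show "integrable lborel (\<lambda>x. \<Sum>r. c r * e r x)"
      using int int_norm norm_summable AE_summable
      by (intro integrable_suminf) (auto simp: has_bochner_integral_iff)
    \<comment> \<open>The terms alternate in sign; nonnegativity of the sum comes from the
      nonnegativity clause of \<open>has_real_density\<close>.\<close>
    show "AE x in lborel. 0 \<le> (\<Sum>r. c r * e r x)"
      using eq d(1) by eventually_elim simp
  qed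
  also have "(\<integral>x. (\<Sum>r. c r * e r x) \<partial>lborel) = (\<Sum>r. \<integral>x. c r * e r x \<partial>lborel)"
    using int int_norm norm_summable AE_summable
    by (intro integral_suminf) (auto simp: has_bochner_integral_iff)
  also have "\<dots> = K * (1 + z) powr - h"
    using sums int by (simp add: has_bochner_integral_iff sums_iff)
  also have "\<dots> = (1 + s powr \<nu> / l) powr - h"
  proof -
    have "1 + s powr \<nu> / l = s powr \<nu> / l * (1 + z)"
      using l s(1) by (simp add: z_def powr_minus field_simps)
    also have "\<dots> powr - h = (s powr \<nu> / l) powr - h * (1 + z) powr - h"
      by (rule powr_mult)
    also have "(s powr \<nu> / l) powr - h = K"
      using l s(1) by (simp add: K_def powr_divide powr_powr powr_minus field_simps)
    finally show ?thesis by simp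
  qed
  finally show ?thesis .
qed

text \<open>
  Expanding at \<open>s\<^sub>0\<close>, the Laplace transform at \<open>s\<^sub>0 - u\<close> with \<open>u \<ge> 0\<close> is a series with nonnegative
  terms, so it agrees with the power series of \<open>G\<close> as far as the latter converges, even where
  finiteness is not known beforehand.
\<close>
lemma laplace_extend:
  fixes X :: "'a \<Rightarrow> real" and s\<^sub>0 \<rho> R :: real and g :: "real \<Rightarrow> real" and G :: "complex \<Rightarrow> complex"
  assumes X [measurable]: "X \<in> borel_measurable M" and pos: "AE \<omega> in M. 0 \<le> X \<omega>"
    and hol: "G holomorphic_on ball (of_real s\<^sub>0) R"
    and G: "\<And>u. 0 \<le> u \<Longrightarrow> u < R \<Longrightarrow> G (of_real (s\<^sub>0 - u)) = of_real (g u)"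
    and g: "\<And>u. 0 \<le> g u" and \<rho>: "0 < \<rho>" "\<rho> < R"
    and local: "\<And>u. 0 \<le> u \<Longrightarrow> u \<le> \<rho> \<Longrightarrow>
      (\<integral>\<^sup>+\<omega>. ennreal (exp (- ((s\<^sub>0 - u) * X \<omega>))) \<partial>M) = ennreal (g u)"
    and u: "0 \<le> u" "u < R"
  shows "(\<integral>\<^sup>+\<omega>. ennreal (exp (- ((s\<^sub>0 - u) * X \<omega>))) \<partial>M) = ennreal (g u)"
proof -
  define m where "m k = (\<integral>\<^sup>+\<omega>. ennreal (X \<omega> ^ k / fact k * exp (- (s\<^sub>0 * X \<omega>))) \<partial>M)" for k :: nat
  have expand: "(\<integral>\<^sup>+\<omega>. ennreal (exp (- ((s\<^sub>0 - u) * X \<omega>))) \<partial>M) = (\<Sum>k. ennreal (u ^ k) * m k)"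
    if "0 \<le> u" for u
  proof -
    have "(\<integral>\<^sup>+\<omega>. ennreal (exp (- ((s\<^sub>0 - u) * X \<omega>))) \<partial>M)
        = (\<integral>\<^sup>+\<omega>. (\<Sum>k. ennreal (u ^ k) * ennreal (X \<omega> ^ k / fact k * exp (- (s\<^sub>0 * X \<omega>)))) \<partial>M)"
    proof (rule nn_integral_cong_AE, use pos in eventually_elim)
      case (elim \<omega>)
      have "(\<lambda>k. (u * X \<omega>) ^ k / fact k * exp (- (s\<^sub>0 * X \<omega>))) sums (exp (u * X \<omega>) * exp (- (s\<^sub>0 * X \<omega>)))"
        using exp_converges[of "u * X \<omega>"] by (intro sums_mult2) (simp add: field_simps)
      then have "(\<Sum>k. ennreal ((u * X \<omega>) ^ k / fact k * exp (- (s\<^sub>0 * X \<omega>))))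
          = ennreal (exp (u * X \<omega>) * exp (- (s\<^sub>0 * X \<omega>)))"
        using that elim by (intro suminf_ennreal_eq) auto
      moreover have "exp (u * X \<omega>) * exp (- (s\<^sub>0 * X \<omega>)) = exp (- ((s\<^sub>0 - u) * X \<omega>))"
        by (simp add: exp_add[symmetric] algebra_simps)
      moreover have "ennreal (u ^ k) * ennreal (X \<omega> ^ k / fact k * exp (- (s\<^sub>0 * X \<omega>)))
          = ennreal ((u * X \<omega>) ^ k / fact k * exp (- (s\<^sub>0 * X \<omega>)))" for k
        using that by (simp add: ennreal_mult'[symmetric] power_mult_distrib mult.assoc)
      ultimately show ?case by (simp only:)
    qed
    also have "\<dots> = (\<Sum>k. ennreal (u ^ k) * m k)"
      unfolding m_def by (subst nn_integral_suminf) (auto intro!: suminf_cong nn_integral_cmult)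
    finally show ?thesis .
  qed
  \<comment> \<open>A single finite value of the transform, at some \<open>\<rho> > 0\<close>,
    bounds every term of the nonnegative series and hence every weighted moment.\<close>
  have m_fin: "m k \<noteq> \<infinity>" for k
  proof
    assume "m k = \<infinity>"
    then have "ennreal (\<rho> ^ k) * m k = \<infinity>" using \<rho> by (simp add: ennreal_mult_top)
    moreover have "ennreal (\<rho> ^ k) * m k < \<infinity>"
    proof (rule ennreal_suminf_lessD[of "\<lambda>k. ennreal (\<rho> ^ k) * m k" \<infinity> k])
      have "(\<Sum>k. ennreal (\<rho> ^ k) * m k) = ennreal (g \<rho>)"
        using expand[of \<rho>] local[of \<rho>] \<rho> by simp
      then show "(\<Sum>k. ennreal (\<rho> ^ k) * m k) < \<infinity>" by simp
    qed
    ultimately show False by simp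
  qed
  define \<mu> where "\<mu> k = enn2real (m k)" for k
  have m: "m k = ennreal (\<mu> k)" for k
    using m_fin[of k] by (simp add: \<mu>_def less_top[symmetric])
  have \<mu>: "0 \<le> \<mu> k" for k by (simp add: \<mu>_def)
  have expand': "(\<integral>\<^sup>+\<omega>. ennreal (exp (- ((s\<^sub>0 - u) * X \<omega>))) \<partial>M) = (\<Sum>k. ennreal (\<mu> k * u ^ k))"
    if "0 \<le> u" for u
    using that unfolding expand[OF that] m by (simp add: ennreal_mult''[symmetric] mult.commute \<mu>)
  have sums_local: "(\<lambda>k. \<mu> k * u ^ k) sums g u" if "0 \<le> u" "u \<le> \<rho>" for u
  proof -
    have "(\<Sum>k. ennreal (\<mu> k * u ^ k)) = ennreal (g u)"
      using expand'[OF that(1)] local[OF that] by simp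
    moreover have nonneg: "0 \<le> \<mu> k * u ^ k" for k using \<mu> that by simp
    ultimately have "summable (\<lambda>k. \<mu> k * u ^ k)" "ennreal (\<Sum>k. \<mu> k * u ^ k) = ennreal (g u)"
      using summable_suminf_not_top[of "\<lambda>k. \<mu> k * u ^ k"] suminf_ennreal[of "\<lambda>k. \<mu> k * u ^ k"] by auto
    then show ?thesis
      using g[of u] nonneg by (simp add: sums_iff suminf_nonneg)
  qed
  \<comment> \<open>These are the Taylor coefficients of \<open>G\<close> as a function of the
    displacement \<open>w\<close> to the left of \<open>s\<^sub>0\<close>, whence the sign.\<close>
  define b where "b k = (deriv ^^ k) G (of_real s\<^sub>0) / fact k * (- 1) ^ k" for k
  have b: "(\<lambda>k. b k * w ^ k) sums G (of_real s\<^sub>0 - w)" if "norm w < R" for w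
  proof -
    have "(\<lambda>k. (deriv ^^ k) G (of_real s\<^sub>0) / fact k * (of_real s\<^sub>0 - w - of_real s\<^sub>0) ^ k)
        sums G (of_real s\<^sub>0 - w)"
      using that by (intro holomorphic_power_series[OF hol]) (simp add: dist_norm)
    then show ?thesis by (simp add: b_def power_minus[of w] mult.assoc)
  qed
  define d where "d k = b k - of_real (\<mu> k)" for k
  have d_sums: "(\<lambda>k. d k * of_real u ^ k) sums 0" if "0 \<le> u" "u \<le> \<rho>" for u
  proof -
    have *: "(\<lambda>k. b k * of_real u ^ k) sums of_real (g u)"
      using b[of "of_real u"] G[of u] that \<rho> by simp
    have "(\<lambda>k. of_real (\<mu> k) * of_real u ^ k :: complex) sums of_real (g u)"
      using sums_of_real[OF sums_local[OF that]] by simp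
    from sums_diff[OF * this] show ?thesis
      by (simp add: d_def left_diff_distrib)
  qed
  \<comment> \<open>A power series with a nonzero coefficient has isolated zeros, but the one with
    coefficients \<open>d\<close> vanishes on the whole segment from 0 to
    \<open>\<rho>\<close>.\<close>
  have "d k = 0" for k
  proof (cases "k = 0")
    case True
    have "(\<lambda>k. d k * 0 ^ k) sums 0" using d_sums[of 0] \<rho> by simp
    then show ?thesis using powser_sums_zero[of d] sums_unique2 True by blast
  next
    case False
    define F where "F w = (\<Sum>k. d k * w ^ k)" for w
    have F: "(\<lambda>k. d k * (w - 0) ^ k) sums F w" if "norm (w - 0) < \<rho>" for w
      using powser_inside[OF sums_summable[OF d_sums[of \<rho>]], of w] that \<rho>
      by (simp add: F_def summable_sums)
    have F0: "F (of_real u) = 0" if "0 \<le> u" "u \<le> \<rho>" for u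
      using d_sums[OF that] by (simp add: F_def sums_iff)
    show ?thesis
    proof (rule ccontr)
      assume "d k \<noteq> 0"
      then obtain q where q: "0 < q" "\<And>z. z \<in> cball 0 q - {0} \<Longrightarrow> F z \<noteq> 0"
        using powser_0_nonzero[OF \<rho>(1) F, of k] F0[of 0] \<rho>(1) False by auto
      have "complex_of_real (min q \<rho>) \<in> cball 0 q - {0}"
        using q(1) \<rho>(1) by (auto simp del: of_real_eq_iff simp: min_def)
      from q(2)[OF this] F0[of "min q \<rho>"] q(1) \<rho>(1) show False by simp
    qed
  qed
  then have bm: "b k = of_real (\<mu> k)" for k by (simp add: d_def)
  \<comment> \<open>Convergence up to \<open>R\<close> is inherited from the Taylor series of
    \<open>G\<close>; finiteness of the transform is part of the conclusion.\<close>
  have "(\<lambda>k. complex_of_real (\<mu> k * u ^ k)) sums of_real (g u)"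
    using b[of "of_real u"] G[OF u] u by (simp add: bm)
  then have "(\<lambda>k. \<mu> k * u ^ k) sums g u" by (simp only: sums_of_real_iff)
  then show ?thesis
    using expand'[OF u(1)] u(1) \<mu> by (simp add: suminf_ennreal_eq sums_iff)
qed

section \<open>The large deviation principle for renewal counts\<close>

lemma elog_ennreal: "0 < x \<Longrightarrow> elog (ennreal x) = ereal (ln x)"
  by (simp add: elog_def)

lemma elog_mono: "a \<le> b \<Longrightarrow> elog a \<le> elog b"
proof (cases "a = 0 \<or> b = \<infinity>")
  case False
  assume ab: "a \<le> b"
  then obtain y where y: "b = ennreal y" "0 \<le> y" using False by (cases b) auto
  then obtain x where x: "a = ennreal x" "0 \<le> x" using False ab by (cases a) (auto simp: top_unique)
  have "0 < x" "x \<le> y" using False x y ab by (auto simp: ennreal_le_iff less_le)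
  then show ?thesis using x y by (simp add: elog_ennreal)
qed (auto simp: elog_def)

text \<open>A constant factor is invisible on the exponential scale because \<open>ln K / t\<close>
  tends to 0; this absorbs all rounding errors below.\<close>

lemma log_rate_tendsto:
  "((\<lambda>t. ereal (1 / t) * ereal (ln (K * exp (- (m * t))))) \<longlongrightarrow> ereal (- m)) at_top"
  if "0 < K" for K m :: real
proof -
  have "((\<lambda>t. ln K * inverse t - m) \<longlongrightarrow> ln K * 0 - m) at_top"
    by (intro tendsto_intros tendsto_inverse_0_at_top filterlim_ident)
  moreover have "\<forall>\<^sub>F t in at_top. ln K * inverse t - m = 1 / t * ln (K * exp (- (m * t)))"
    using eventually_gt_at_top[of 0]
  proof eventually_elim
    case (elim t)
    then show ?case using that by (simp add: ln_mult field_simps)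
  qed
  ultimately have "((\<lambda>t. 1 / t * ln (K * exp (- (m * t)))) \<longlongrightarrow> - m) at_top"
    by (simp add: tendsto_cong)
  then show ?thesis by simp
qed

lemma Limsup_log_rate_le:
  fixes P :: "real \<Rightarrow> ennreal"
  assumes "0 < K" "\<And>t. 0 < t \<Longrightarrow> P t \<le> ennreal (K * exp (- (m * t)))"
  shows "Limsup at_top (\<lambda>t. ereal (1 / t) * elog (P t)) \<le> ereal (- m)"
proof -
  have "Limsup at_top (\<lambda>t. ereal (1 / t) * elog (P t))
      \<le> Limsup at_top (\<lambda>t. ereal (1 / t) * ereal (ln (K * exp (- (m * t)))))"
  proof (rule Limsup_mono)
    show "\<forall>\<^sub>F t in at_top. ereal (1 / t) * elog (P t) \<le> ereal (1 / t) * ereal (ln (K * exp (- (m * t))))"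
      using eventually_gt_at_top[of 0]
    proof eventually_elim
      case (elim t)
      have "elog (P t) \<le> elog (ennreal (K * exp (- (m * t))))"
        using assms(2) elim by (intro elog_mono) simp
      then show ?case
        using elim assms(1) by (intro ereal_mult_left_mono) (auto simp: elog_ennreal)
    qed
  qed
  also have "\<dots> = ereal (- m)"
    by (intro lim_imp_Limsup log_rate_tendsto assms(1) trivial_limit_at_top_linorder)
  finally show ?thesis .
qed

lemma Liminf_log_rate_ge:
  fixes P :: "real \<Rightarrow> ennreal"
  assumes "0 < K" "\<forall>\<^sub>F t in at_top. ennreal (K * exp (- (m * t))) \<le> P t"
  shows "ereal (- m) \<le> Liminf at_top (\<lambda>t. ereal (1 / t) * elog (P t))"
proof -
  have "ereal (- m) = Liminf at_top (\<lambda>t. ereal (1 / t) * ereal (ln (K * exp (- (m * t)))))"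
    by (rule sym, intro lim_imp_Liminf log_rate_tendsto assms(1) trivial_limit_at_top_linorder)
  also have "\<dots> \<le> Liminf at_top (\<lambda>t. ereal (1 / t) * elog (P t))"
  proof (rule Liminf_mono)
    show "\<forall>\<^sub>F t in at_top. ereal (1 / t) * ereal (ln (K * exp (- (m * t)))) \<le> ereal (1 / t) * elog (P t)"
      using eventually_gt_at_top[of 0] assms(2)
    proof eventually_elim
      case (elim t)
      have "elog (ennreal (K * exp (- (m * t)))) \<le> elog (P t)"
        using elim by (intro elog_mono) simp
      then show ?case
        using elim assms(1) by (intro ereal_mult_left_mono) (auto simp: elog_ennreal)
    qed
  qed
  finally show ?thesis .
qed

text \<open>For injective \<open>\<psi>\<close> and \<open>x \<ge> 0\<close> this is the Legendre
  transform of the inverse of \<open>\<psi>\<close>, taken over the range of \<open>\<psi>\<close>.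
  For \<open>x < 0\<close> the value is imposed: with \<open>D = {0..}\<close>,
  \<open>\<psi> 0 = 0\<close> and \<open>\<psi> \<ge> 0\<close> on \<open>D\<close> the supremum
  would be 0 there.\<close>

definition dual_rate :: "real set \<Rightarrow> (real \<Rightarrow> real) \<Rightarrow> real \<Rightarrow> ereal" where
  "dual_rate D \<psi> x = (if x < 0 then \<infinity> else SUP s\<in>D. ereal (x * \<psi> s - s))"

lemma dual_rate_ge: "0 \<le> x \<Longrightarrow> s \<in> D \<Longrightarrow> ereal (x * \<psi> s - s) \<le> dual_rate D \<psi> x"
  by (auto simp: dual_rate_def intro: SUP_upper2)

text \<open>The waiting times enter only through independence, positivity and their Laplace
  transform on \<open>D\<close>; that they share one law is expressed by \<open>\<psi>\<close> not
  depending on \<open>n\<close>.\<close>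

locale renewal_process = prob_space M for M :: "'a measure" +
  fixes T :: "nat \<Rightarrow> 'a \<Rightarrow> real" and D :: "real set" and \<psi> :: "real \<Rightarrow> real"
  assumes indep: "indep_vars (\<lambda>_. borel) T {1..}"
    and pos: "1 \<le> n \<Longrightarrow> AE \<omega> in M. 0 < T n \<omega>"
    and laplace: "1 \<le> n \<Longrightarrow> s \<in> D \<Longrightarrow>
      (\<integral>\<^sup>+\<omega>. ennreal (exp (- (s * T n \<omega>))) \<partial>M) = ennreal (exp (- \<psi> s))"
begin

definition S :: "nat \<Rightarrow> 'a \<Rightarrow> real" where
  "S n \<omega> = (\<Sum>k = 1..n. T k \<omega>)"

text \<open>\<open>enn2real\<close> turns an infinite count into 0, so a small value of
  \<open>Z\<close> says something about the partial sums only where the count is finite.\<close>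

definition Z :: "real \<Rightarrow> 'a \<Rightarrow> real" where
  "Z t \<omega> = enn2real (renewal_count T t \<omega>) / t"

lemma measurable_T: "1 \<le> n \<Longrightarrow> T n \<in> borel_measurable M"
  using indep by (auto simp: indep_vars_def)

lemma measurable_S [measurable]: "S n \<in> borel_measurable M"
  unfolding S_def[abs_def] by (intro borel_measurable_sum measurable_T) auto

lemma measurable_Z [measurable]: "Z t \<in> borel_measurable M"
proof -
  have "renewal_count T t = (\<lambda>\<omega>. \<Sum>n. indicator {..t} (S (Suc n) \<omega>))"
    by (simp add: renewal_count_def S_def fun_eq_iff)
  then have "renewal_count T t \<in> borel_measurable M" by simp
  then show ?thesis unfolding Z_def[abs_def] by measurable
qed

text \<open>The parameter may vary with the index because the tilted estimate later shifts it on an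
  initial block of summands only.\<close>

lemma laplace_sum:
  assumes "\<And>k. k \<in> {1..n} \<Longrightarrow> c k \<in> D"
  shows "(\<integral>\<^sup>+\<omega>. ennreal (exp (- (\<Sum>k = 1..n. c k * T k \<omega>))) \<partial>M)
    = ennreal (exp (- (\<Sum>k = 1..n. \<psi> (c k))))"
proof -
  have i: "indep_vars (\<lambda>_. borel) (\<lambda>k \<omega>. ennreal (exp (- (c k * T k \<omega>)))) {1..n}"
    by (rule indep_vars_compose2[OF indep_vars_subset[OF indep]]) auto
  have "(\<integral>\<^sup>+\<omega>. ennreal (exp (- (\<Sum>k = 1..n. c k * T k \<omega>))) \<partial>M)
      = (\<integral>\<^sup>+\<omega>. (\<Prod>k = 1..n. ennreal (exp (- (c k * T k \<omega>)))) \<partial>M)"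
    by (simp add: prod_ennreal exp_sum sum_negf[symmetric])
  also have "\<dots> = (\<Prod>k = 1..n. \<integral>\<^sup>+\<omega>. ennreal (exp (- (c k * T k \<omega>))) \<partial>M)"
    by (rule indep_vars_nn_integral[OF _ i]) auto
  also have "\<dots> = (\<Prod>k = 1..n. ennreal (exp (- \<psi> (c k))))"
    using assms by (intro prod.cong refl laplace) auto
  also have "\<dots> = ennreal (exp (- (\<Sum>k = 1..n. \<psi> (c k))))"
    by (simp add: prod_ennreal exp_sum sum_negf[symmetric])
  finally show ?thesis .
qed

text \<open>On \<open>A\<close> the weight is dominated by an exponential of a linear form in the
  summands, whose integral is explicit. \<open>W = 0\<close> gives tail probabilities, and
  \<open>W = - s * S m\<close> gives the same bounds under a tilt.\<close>

lemma chernoff: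
  assumes "\<And>k. k \<in> {1..n} \<Longrightarrow> c k \<in> D"
    and "\<And>\<omega>. \<omega> \<in> A \<Longrightarrow> W \<omega> \<le> B - (\<Sum>k = 1..n. c k * T k \<omega>)"
  shows "(\<integral>\<^sup>+\<omega>. ennreal (exp (W \<omega>)) * indicator A \<omega> \<partial>M) \<le> ennreal (exp (B - (\<Sum>k = 1..n. \<psi> (c k))))"
proof -
  have m: "(\<lambda>\<omega>. \<Sum>k = 1..n. c k * T k \<omega>) \<in> borel_measurable M"
    by (intro borel_measurable_sum borel_measurable_times measurable_T) auto
  have "(\<integral>\<^sup>+\<omega>. ennreal (exp (W \<omega>)) * indicator A \<omega> \<partial>M)
      \<le> (\<integral>\<^sup>+\<omega>. ennreal (exp B) * ennreal (exp (- (\<Sum>k = 1..n. c k * T k \<omega>))) \<partial>M)"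
    using assms(2)
    by (intro nn_integral_mono)
       (auto simp: indicator_def ennreal_mult'[symmetric] exp_add[symmetric] intro!: ennreal_leI)
  also have "\<dots> = ennreal (exp B) * ennreal (exp (- (\<Sum>k = 1..n. \<psi> (c k))))"
    using m by (subst nn_integral_cmult, simp, subst laplace_sum[OF assms(1)]) auto
  finally show ?thesis
    by (simp add: ennreal_mult'[symmetric] exp_add[symmetric])
qed

lemma emeasure_le_chernoff:
  assumes "s \<in> D" "A \<in> sets M" "\<And>\<omega>. \<omega> \<in> A \<Longrightarrow> s * S n \<omega> \<le> B"
  shows "emeasure M A \<le> ennreal (exp (B - real n * \<psi> s))"
proof -
  have "emeasure M A = (\<integral>\<^sup>+\<omega>. ennreal (exp 0) * indicator A \<omega> \<partial>M)"
    using assms(2) by simp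
  also have "\<dots> \<le> ennreal (exp (B - (\<Sum>k = 1..n. \<psi> s)))"
    using assms(1,3) by (intro chernoff) (auto simp: S_def sum_distrib_left)
  finally show ?thesis by simp
qed

lemma AE_pos: "AE \<omega> in M. \<forall>n\<ge>1. 0 < T n \<omega>"
  unfolding AE_all_countable
proof
  fix n show "AE \<omega> in M. 1 \<le> n \<longrightarrow> 0 < T n \<omega>"
    using pos[of n] by (cases "1 \<le> n") auto
qed

section \<open>From partial sums to counts\<close>

lemma S_mono: "\<forall>n\<ge>1. 0 < T n \<omega> \<Longrightarrow> m \<le> n \<Longrightarrow> S m \<omega> \<le> S n \<omega>"
  unfolding S_def by (intro sum_mono2) (auto intro: less_imp_le)

lemma renewal_count_S: "renewal_count T t \<omega> = (\<Sum>n. indicator {..t} (S (Suc n) \<omega>))"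
  by (simp add: renewal_count_def S_def)

lemma renewal_count_ge:
  assumes p: "\<forall>n\<ge>1. 0 < T n \<omega>" and "S n \<omega> \<le> t"
  shows "of_nat n \<le> renewal_count T t \<omega>"
proof -
  have "S (Suc i) \<omega> \<le> t" if "i < n" for i
    using S_mono[OF p, of "Suc i" n] that assms(2) by simp
  then have "(of_nat n :: ennreal) = (\<Sum>i<n. indicator {..t} (S (Suc i) \<omega>))"
    by simp
  also have "\<dots> \<le> renewal_count T t \<omega>"
    unfolding renewal_count_S by (intro sum_le_suminf) auto
  finally show ?thesis .
qed

lemma renewal_count_less:
  assumes p: "\<forall>n\<ge>1. 0 < T n \<omega>" and "t < S n \<omega>"
  shows "renewal_count T t \<omega> \<le> of_nat (n - 1)"
proof -
  \<comment> \<open>The summand with index \<open>i\<close> concerns \<open>S (Suc i)\<close>, hence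
    the bound \<open>n - 1\<close> instead of \<open>n\<close>.\<close>
  have z: "\<not> S (Suc i) \<omega> \<le> t" if "n - 1 \<le> i" for i
  proof -
    have "n \<le> Suc i" using that by simp
    then show ?thesis using S_mono[OF p, of n "Suc i"] assms(2) by simp
  qed
  have "renewal_count T t \<omega> = (\<Sum>i<n - 1. indicator {..t} (S (Suc i) \<omega>))"
    unfolding renewal_count_S using z by (intro suminf_finite) (auto simp: not_less)
  also have "\<dots> \<le> (\<Sum>i<n - 1. 1)"
    by (intro sum_mono) (simp add: indicator_def)
  finally show ?thesis by simp
qed


text \<open>An infinite count forces all partial sums below \<open>t\<close>; the Chernoff bound for
  \<open>S n\<close> holds for every \<open>n\<close> and tends to 0 because
  \<open>\<psi> s > 0\<close>.\<close>

lemma AE_renewal_count_finite: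
  assumes "s \<in> D" "0 \<le> s" "0 < \<psi> s"
  shows "AE \<omega> in M. renewal_count T t \<omega> \<noteq> \<infinity>"
proof -
  have le: "emeasure M {\<omega>\<in>space M. \<forall>n. S n \<omega> \<le> t} \<le> ennreal (exp (s * t - real n * \<psi> s))" for n
    using assms by (intro emeasure_le_chernoff) (auto intro!: mult_left_mono)
  have "((\<lambda>n. ennreal (exp (s * t - real n * \<psi> s))) \<longlongrightarrow> ennreal 0) sequentially"
    using assms(3) by (intro tendsto_ennrealI) real_asymp
  then have "emeasure M {\<omega>\<in>space M. \<forall>n. S n \<omega> \<le> t} \<le> ennreal 0"
    by (rule tendsto_lowerbound) (auto simp: le)
  then have "AE \<omega> in M. \<not> (\<forall>n. S n \<omega> \<le> t)"
    by (subst AE_iff_measurable[OF _ refl]) auto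
  with AE_pos show ?thesis
  proof eventually_elim
    case (elim \<omega>)
    then obtain n where "t < S n \<omega>" by (auto simp: not_le)
    from renewal_count_less[OF elim(1) this] show ?case
      by (auto simp: top_unique)
  qed
qed

lemma Z_nonneg: "0 < t \<Longrightarrow> 0 \<le> Z t \<omega>"
  by (simp add: Z_def)

lemma S_le_if_Z_ge:
  assumes "\<forall>n\<ge>1. 0 < T n \<omega>" "0 < t" "0 < b" "b \<le> Z t \<omega>"
  shows "S (nat \<lceil>b * t\<rceil>) \<omega> \<le> t"
proof (rule ccontr)
  let ?n = "nat \<lceil>b * t\<rceil>"
  assume "\<not> S ?n \<omega> \<le> t"
  then have "renewal_count T t \<omega> \<le> of_nat (?n - 1)"
    by (intro renewal_count_less[OF assms(1)]) simp
  then have "enn2real (renewal_count T t \<omega>) \<le> enn2real (of_nat (?n - 1))"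
    by (intro enn2real_mono) (auto simp: less_top[symmetric])
  then have "b * t \<le> real (?n - 1)"
    using assms by (simp add: Z_def field_simps)
  moreover have "0 < b * t" using assms by simp
  ultimately show False by linarith
qed

text \<open>\<open>nat \<lfloor>a * t\<rfloor> + 1\<close> is the first integer above
  \<open>a * t\<close>, a number of renewals that has not been reached by time \<open>t\<close>.
  Finiteness excludes the points where \<open>Z\<close> is 0 because the count is infinite.\<close>

lemma less_S_if_Z_le:
  assumes "\<forall>n\<ge>1. 0 < T n \<omega>" "renewal_count T t \<omega> \<noteq> \<infinity>" "0 < t" "Z t \<omega> \<le> a"
  shows "t < S (nat \<lfloor>a * t\<rfloor> + 1) \<omega>"
proof (rule ccontr)
  let ?n = "nat \<lfloor>a * t\<rfloor> + 1"
  assume "\<not> t < S ?n \<omega>"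
  then have "of_nat ?n \<le> renewal_count T t \<omega>"
    by (intro renewal_count_ge[OF assms(1)]) simp
  then have "enn2real (of_nat ?n) \<le> enn2real (renewal_count T t \<omega>)"
    using assms(2) by (intro enn2real_mono) (auto simp: less_top[symmetric])
  then have "real ?n \<le> enn2real (renewal_count T t \<omega>)"
    by (simp only: enn2real_of_nat)
  also have "\<dots> \<le> a * t"
    using assms by (simp add: Z_def field_simps)
  finally show False by linarith
qed

lemma Z_mem_if_S:
  assumes "\<forall>n\<ge>1. 0 < T n \<omega>" "0 < t" "0 < b" "S (nat \<lceil>a * t\<rceil>) \<omega> \<le> t" "t < S (nat \<lceil>b * t\<rceil>) \<omega>"
  shows "Z t \<omega> \<in> {a..b}"
proof -
  let ?n = "nat \<lceil>a * t\<rceil>" and ?m = "nat \<lceil>b * t\<rceil>"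
  have l: "of_nat ?n \<le> renewal_count T t \<omega>"
    by (rule renewal_count_ge[OF assms(1,4)])
  \<comment> \<open>This bound also rules out an infinite count.\<close>
  have u: "renewal_count T t \<omega> \<le> of_nat (?m - 1)"
    by (rule renewal_count_less[OF assms(1,5)])
  have "enn2real (of_nat ?n) \<le> enn2real (renewal_count T t \<omega>)"
    using l u by (intro enn2real_mono) (auto simp: less_top[symmetric] top_unique)
  moreover have "enn2real (renewal_count T t \<omega>) \<le> enn2real (of_nat (?m - 1))"
    using u by (intro enn2real_mono) (auto simp: less_top[symmetric])
  moreover have "a * t \<le> real ?n" by linarith
  moreover have "real (?m - 1) \<le> b * t"
    using mult_pos_pos[OF assms(3,2)] by linarith
  ultimately show ?thesis using assms(2) by (simp add: Z_def field_simps)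
qed

text \<open>Rounding \<open>b * t\<close> up only helps, since each further summand contributes the
  factor \<open>exp (- \<psi> s) \<le> 1\<close>.\<close>

lemma upper_tail:
  assumes "s \<in> D" "0 \<le> s" "0 \<le> \<psi> s" "0 < t" "0 < b"
  shows "emeasure M {\<omega>\<in>space M. b \<le> Z t \<omega>} \<le> ennreal (exp (- ((b * \<psi> s - s) * t)))"
proof -
  let ?n = "nat \<lceil>b * t\<rceil>"
  have "AE \<omega> in M. b \<le> Z t \<omega> \<longrightarrow> S ?n \<omega> \<le> t"
    using AE_pos by eventually_elim (use assms S_le_if_Z_ge in auto)
  then have "emeasure M {\<omega>\<in>space M. b \<le> Z t \<omega>} \<le> emeasure M {\<omega>\<in>space M. S ?n \<omega> \<le> t}"
    by (intro emeasure_mono_AE) auto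
  also have "\<dots> \<le> ennreal (exp (s * t - real ?n * \<psi> s))"
    using assms by (intro emeasure_le_chernoff) (auto intro!: mult_left_mono)
  also have "\<dots> \<le> ennreal (exp (- ((b * \<psi> s - s) * t)))"
  proof -
    have "b * t * \<psi> s \<le> real ?n * \<psi> s"
      using assms(3) by (intro mult_right_mono) linarith
    then show ?thesis by (intro ennreal_leI) (simp add: algebra_simps)
  qed
  finally show ?thesis .
qed

text \<open>Here each summand contributes a factor at least 1, and rounding adds at most one
  summand: this is the prefactor \<open>exp (- \<psi> s)\<close>.\<close>

lemma lower_tail:
  assumes "s \<in> D" "s \<le> 0" "\<psi> s \<le> 0" "0 < t" "0 \<le> a"
    and fin: "AE \<omega> in M. renewal_count T t \<omega> \<noteq> \<infinity>"
  shows "emeasure M {\<omega>\<in>space M. Z t \<omega> \<le> a} \<le> ennreal (exp (- \<psi> s) * exp (- ((a * \<psi> s - s) * t)))"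
proof -
  let ?n = "nat \<lfloor>a * t\<rfloor> + 1"
  have "AE \<omega> in M. Z t \<omega> \<le> a \<longrightarrow> t < S ?n \<omega>"
    using AE_pos fin by eventually_elim (use assms less_S_if_Z_le in blast)
  then have "emeasure M {\<omega>\<in>space M. Z t \<omega> \<le> a} \<le> emeasure M {\<omega>\<in>space M. t < S ?n \<omega>}"
    by (intro emeasure_mono_AE) auto
  also have "\<dots> \<le> ennreal (exp (s * t - real ?n * \<psi> s))"
    using assms by (intro emeasure_le_chernoff) (auto intro!: mult_left_mono_neg)
  also have "\<dots> \<le> ennreal (exp (- \<psi> s) * exp (- ((a * \<psi> s - s) * t)))"
  proof -
    have "(a * t + 1) * \<psi> s \<le> real ?n * \<psi> s"
      using assms(3,4,5) by (intro mult_right_mono_neg) (auto simp: of_nat_nat)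
    then show ?thesis by (intro ennreal_leI) (simp add: algebra_simps exp_add[symmetric])
  qed
  finally show ?thesis .
qed


section \<open>Tilted lower bound\<close>

text \<open>
  Exponential tilting without a change of measure: the three summands in \<open>small\<close> bound the relative
  weight, with respect to \<open>exp (- s S\<^sub>m)\<close>, of the events \<open>t < S\<^sub>n\<close>, \<open>S\<^sub>m \<le> t\<close> and \<open>t (1 + \<kappa>) < S\<^sub>m\<close>.
\<close>
lemma prob_window_ge:
  fixes s \<eta> \<kappa> t :: real and n m :: nat
  defines "\<Delta> \<equiv> \<psi> s - \<psi> (s - \<eta>)" and "\<Delta>' \<equiv> \<psi> (s + \<eta>) - \<psi> s"
  assumes D: "s \<in> D" "s - \<eta> \<in> D" "s + \<eta> \<in> D" and "0 < \<eta>" "0 < \<kappa>" "0 < t" "n \<le> m"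
    and small: "exp (real n * \<Delta> - \<eta> * t) + exp (\<eta> * t - real m * \<Delta>')
      + exp (real m * \<Delta> - \<eta> * (t * (1 + \<kappa>))) \<le> 1 / 2"
  shows "1 / 2 * exp (s * t - \<bar>s\<bar> * \<kappa> * t - real m * \<psi> s)
    \<le> measure M {\<omega>\<in>space M. S n \<omega> \<le> t \<and> t < S m \<omega>}"
proof -
  define W where "W \<omega> = - (s * S m \<omega>)" for \<omega>
  define e where "e = exp (- (real m * \<psi> s))"
  define c where "c = exp (- (s * t) + \<bar>s\<bar> * \<kappa> * t)"
  define A where "A = {\<omega>\<in>space M. S n \<omega> \<le> t \<and> t < S m \<omega> \<and> S m \<omega> \<le> t * (1 + \<kappa>)}"
  define A1 where "A1 = {\<omega>\<in>space M. t < S n \<omega>}"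
  define A2 where "A2 = {\<omega>\<in>space M. S m \<omega> \<le> t}"
  \<comment> \<open>For \<open>s < 0\<close> the weight grows with \<open>S m\<close>, so a large
    overshoot beyond \<open>t\<close> must be removed before the weight on \<open>A\<close> can be
    bounded by \<open>c\<close>.\<close>
  define A3 where "A3 = {\<omega>\<in>space M. t * (1 + \<kappa>) < S m \<omega>}"
  note A_defs = A_def A1_def A2_def A3_def
  have [measurable]: "A \<in> sets M" "A1 \<in> sets M" "A2 \<in> sets M" "A3 \<in> sets M"
    "W \<in> borel_measurable M"
    unfolding A_defs W_def[abs_def] by measurable
  let ?I = "\<lambda>B. \<integral>\<^sup>+\<omega>. ennreal (exp (W \<omega>)) * indicator B \<omega> \<partial>M"
  have split: "(\<Sum>k = 1..m. if k \<le> n then f k else 0) = (\<Sum>k = 1..n. f k)" for f :: "nat \<Rightarrow> real"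
    using \<open>n \<le> m\<close> by (intro sum.mono_neutral_cong_right) auto
  \<comment> \<open>The event concerns \<open>S n\<close> but the weight involves all
    \<open>m\<close> summands, so the parameter is lowered by \<open>\<eta>\<close> on the first
    \<open>n\<close> and stays \<open>s\<close> on the others.\<close>
  have "?I A1 \<le> ennreal (exp (- (\<eta> * t) - (\<Sum>k = 1..m. \<psi> (if k \<le> n then s - \<eta> else s))))"
  proof (rule chernoff)
    fix \<omega> assume "\<omega> \<in> A1"
    then have "\<eta> * t \<le> \<eta> * S n \<omega>" using \<open>0 < \<eta>\<close> by (simp add: A1_def)
    moreover have "(\<Sum>k = 1..m. (if k \<le> n then s - \<eta> else s) * T k \<omega>)
        = (\<Sum>k = 1..m. s * T k \<omega> - (if k \<le> n then \<eta> * T k \<omega> else 0))"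
      by (intro sum.cong) (auto simp: algebra_simps)
    moreover have "\<dots> = s * S m \<omega> - \<eta> * S n \<omega>"
      unfolding sum_subtractf split by (simp add: S_def sum_distrib_left)
    ultimately show "W \<omega> \<le> - (\<eta> * t) - (\<Sum>k = 1..m. (if k \<le> n then s - \<eta> else s) * T k \<omega>)"
      by (simp add: W_def)
  qed (use D in auto)
  also have "(\<Sum>k = 1..m. \<psi> (if k \<le> n then s - \<eta> else s)) = (\<Sum>k = 1..m. \<psi> s - (if k \<le> n then \<Delta> else 0))"
    by (intro sum.cong) (auto simp: \<Delta>_def)
  also have "\<dots> = real m * \<psi> s - real n * \<Delta>"
    unfolding sum_subtractf split by simp
  also have "exp (- (\<eta> * t) - (real m * \<psi> s - real n * \<Delta>)) = e * exp (real n * \<Delta> - \<eta> * t)"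
    by (simp add: e_def exp_add[symmetric])
  finally have I1: "?I A1 \<le> ennreal (e * exp (real n * \<Delta> - \<eta> * t))" .
  have "?I A2 \<le> ennreal (exp (\<eta> * t - (\<Sum>k = 1..m. \<psi> (s + \<eta>))))"
  proof (rule chernoff)
    fix \<omega> assume "\<omega> \<in> A2"
    then have "\<eta> * S m \<omega> \<le> \<eta> * t" using \<open>0 < \<eta>\<close> by (simp add: A2_def)
    moreover have "(\<Sum>k = 1..m. (s + \<eta>) * T k \<omega>) = s * S m \<omega> + \<eta> * S m \<omega>"
      unfolding S_def sum_distrib_left[symmetric] by (rule distrib_right)
    ultimately show "W \<omega> \<le> \<eta> * t - (\<Sum>k = 1..m. (s + \<eta>) * T k \<omega>)"
      by (simp add: W_def)
  qed (use D in auto)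
  also have "exp (\<eta> * t - (\<Sum>k = 1..m. \<psi> (s + \<eta>))) = e * exp (\<eta> * t - real m * \<Delta>')"
    by (simp add: e_def exp_add[symmetric] \<Delta>'_def algebra_simps)
  finally have I2: "?I A2 \<le> ennreal (e * exp (\<eta> * t - real m * \<Delta>'))" .
  have "?I A3 \<le> ennreal (exp (- (\<eta> * (t * (1 + \<kappa>))) - (\<Sum>k = 1..m. \<psi> (s - \<eta>))))"
  proof (rule chernoff)
    fix \<omega> assume "\<omega> \<in> A3"
    then have "\<eta> * (t * (1 + \<kappa>)) \<le> \<eta> * S m \<omega>" using \<open>0 < \<eta>\<close> by (simp add: A3_def)
    moreover have "(\<Sum>k = 1..m. (s - \<eta>) * T k \<omega>) = s * S m \<omega> - \<eta> * S m \<omega>"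
      unfolding S_def sum_distrib_left[symmetric] by (rule left_diff_distrib)
    ultimately show "W \<omega> \<le> - (\<eta> * (t * (1 + \<kappa>))) - (\<Sum>k = 1..m. (s - \<eta>) * T k \<omega>)"
      by (simp add: W_def)
  qed (use D in auto)
  also have "exp (- (\<eta> * (t * (1 + \<kappa>))) - (\<Sum>k = 1..m. \<psi> (s - \<eta>)))
      = e * exp (real m * \<Delta> - \<eta> * (t * (1 + \<kappa>)))"
    by (simp add: e_def exp_add[symmetric] \<Delta>_def algebra_simps)
  finally have I3: "?I A3 \<le> ennreal (e * exp (real m * \<Delta> - \<eta> * (t * (1 + \<kappa>))))" .
  have "?I A \<le> (\<integral>\<^sup>+\<omega>. ennreal c * indicator A \<omega> \<partial>M)"
  proof (rule nn_integral_mono)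
    fix \<omega>
    have "W \<omega> \<le> - (s * t) + \<bar>s\<bar> * \<kappa> * t" if "\<omega> \<in> A"
    proof -
      have "\<bar>s\<bar> * \<bar>S m \<omega> - t\<bar> \<le> \<bar>s\<bar> * (\<kappa> * t)"
        using that by (intro mult_left_mono) (auto simp: A_def algebra_simps)
      moreover have "- (s * (S m \<omega> - t)) \<le> \<bar>s\<bar> * \<bar>S m \<omega> - t\<bar>"
        by (metis abs_ge_minus_self abs_mult)
      ultimately show ?thesis by (simp add: W_def algebra_simps)
    qed
    then show "ennreal (exp (W \<omega>)) * indicator A \<omega> \<le> ennreal c * indicator A \<omega>"
      by (auto simp: indicator_def c_def intro!: ennreal_leI)
  qed
  also have "\<dots> = ennreal (c * measure M A)"
    by (simp add: nn_integral_cmult_indicator emeasure_eq_measure ennreal_mult' c_def)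
  finally have I0: "?I A \<le> ennreal (c * measure M A)" .
  have "ennreal e = (\<integral>\<^sup>+\<omega>. ennreal (exp (- (\<Sum>k = 1..m. s * T k \<omega>))) \<partial>M)"
    using D by (subst laplace_sum) (auto simp: e_def)
  also have "\<dots> = (\<integral>\<^sup>+\<omega>. ennreal (exp (W \<omega>)) \<partial>M)"
    by (simp add: W_def S_def sum_distrib_left)
  \<comment> \<open>The four events cover the sample space. By \<open>small\<close> the last three
    carry at most half of the total weight \<open>e\<close>, so \<open>A\<close> carries at least
    the other half, with weight at most \<open>c\<close> at each point.\<close>
  also have "\<dots> \<le> (\<integral>\<^sup>+\<omega>. ennreal (exp (W \<omega>)) * indicator A \<omega> + ennreal (exp (W \<omega>)) * indicator A1 \<omega>
      + ennreal (exp (W \<omega>)) * indicator A2 \<omega> + ennreal (exp (W \<omega>)) * indicator A3 \<omega> \<partial>M)"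
    by (intro nn_integral_mono) (auto simp: A_defs indicator_def not_le not_less)
  also have "\<dots> = ?I A + ?I A1 + ?I A2 + ?I A3"
    by (simp add: nn_integral_add)
  also have "\<dots> \<le> ennreal (c * measure M A) + ennreal (e * exp (real n * \<Delta> - \<eta> * t))
      + ennreal (e * exp (\<eta> * t - real m * \<Delta>')) + ennreal (e * exp (real m * \<Delta> - \<eta> * (t * (1 + \<kappa>))))"
    by (intro add_mono I0 I1 I2 I3)
  also have "\<dots> = ennreal (c * measure M A + e * exp (real n * \<Delta> - \<eta> * t)
      + e * exp (\<eta> * t - real m * \<Delta>') + e * exp (real m * \<Delta> - \<eta> * (t * (1 + \<kappa>))))"
    by (simp add: c_def e_def)
  finally have "e \<le> c * measure M A + e * exp (real n * \<Delta> - \<eta> * t)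
      + e * exp (\<eta> * t - real m * \<Delta>') + e * exp (real m * \<Delta> - \<eta> * (t * (1 + \<kappa>)))"
    by (subst (asm) ennreal_le_iff) (auto simp: c_def e_def)
  also have "\<dots> = c * measure M A + e * (exp (real n * \<Delta> - \<eta> * t)
      + exp (\<eta> * t - real m * \<Delta>') + exp (real m * \<Delta> - \<eta> * (t * (1 + \<kappa>))))"
    by (simp add: algebra_simps)
  also have "\<dots> \<le> c * measure M A + e * (1 / 2)"
    using small by (intro add_left_mono mult_left_mono) (auto simp: e_def)
  finally have "1 / 2 * (e / c) \<le> measure M A"
    by (simp add: c_def field_simps)
  also have "\<dots> \<le> measure M {\<omega>\<in>space M. S n \<omega> \<le> t \<and> t < S m \<omega>}"
    by (intro finite_measure_mono) (auto simp: A_def)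
  also have "e / c = exp (s * t - \<bar>s\<bar> * \<kappa> * t - real m * \<psi> s)"
    by (simp add: e_def c_def exp_diff[symmetric] algebra_simps)
  finally show ?thesis .
qed


text \<open>Under the tilt the sums of about \<open>a * t\<close> and \<open>b * t\<close> terms
  have means near \<open>a * t / x < t\<close> and \<open>b * t / x > t\<close>, so the window event
  is typical. Undoing the tilt costs the stated exponent.\<close>

lemma Liminf_local_ge:
  assumes x: "0 < a" "a < x" "x < b" and s: "s \<in> interior D"
    and deriv: "(\<psi> has_real_derivative 1 / x) (at s)"
    and G: "{a..b} \<subseteq> G" "G \<in> sets borel"
  shows "ereal (- (b * \<psi> s - s + \<bar>s\<bar> * (2 * (b - x) / x)))
    \<le> Liminf at_top (\<lambda>t. ereal (1 / t) * elog (emeasure M {\<omega>\<in>space M. Z t \<omega> \<in> G}))"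
proof -
  \<comment> \<open>As \<open>b / x = 1 + (b - x) / x\<close>, doubling the excess puts
    \<open>t * (1 + \<kappa>)\<close> strictly above the tilted mean of the longer sum, and
    \<open>\<kappa>\<close> still vanishes as \<open>b\<close> decreases to
    \<open>x\<close>.\<close>
  define \<kappa> where "\<kappa> = 2 * (b - x) / x"
  have \<kappa>: "0 < \<kappa>" "1 / x < (1 + \<kappa>) / b" "1 / x < 1 / a" "1 / b < 1 / x"
    using x by (auto simp: \<kappa>_def field_simps)
  have lim: "((\<lambda>h. (\<psi> (s + h) - \<psi> s) / h) \<longlongrightarrow> 1 / x) (at 0)"
    using deriv by (simp add: DERIV_def)
  have lim_right: "((\<lambda>h. (\<psi> (s + h) - \<psi> s) / h) \<longlongrightarrow> 1 / x) (at_right 0)"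
    using lim by (rule filterlim_mono) (auto simp: at_le)
  have "((\<lambda>h. (\<psi> (s + - h) - \<psi> s) / - h) \<longlongrightarrow> 1 / x) (at_right 0)"
    using lim by (rule filterlim_compose) real_asymp
  then have lim_left: "((\<lambda>h. (\<psi> s - \<psi> (s - h)) / h) \<longlongrightarrow> 1 / x) (at_right 0)"
    by (simp add: minus_divide_left)
  have "\<forall>\<^sub>F y in nhds s. y \<in> interior D"
    using s by (intro eventually_nhds_in_open) auto
  then have "\<forall>\<^sub>F h in at_right 0. s + h \<in> interior D" "\<forall>\<^sub>F h in at_right 0. s - h \<in> interior D"
    by (rule eventually_compose_filterlim; real_asymp)+
  then have "\<forall>\<^sub>F h in at_right 0. 0 < h \<and> s + h \<in> D \<and> s - h \<in> D \<and>
      1 / b < (\<psi> (s + h) - \<psi> s) / h \<and> (\<psi> s - \<psi> (s - h)) / h < 1 / a \<and>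
      (\<psi> s - \<psi> (s - h)) / h < (1 + \<kappa>) / b"
    using order_tendstoD(1)[OF lim_right \<kappa>(4)] order_tendstoD(2)[OF lim_left \<kappa>(3)]
      order_tendstoD(2)[OF lim_left \<kappa>(2)] eventually_at_right_less[of 0]
    by eventually_elim (use interior_subset in auto)
  then obtain \<eta> where \<eta>: "0 < \<eta>" "s + \<eta> \<in> D" "s - \<eta> \<in> D"
    and ineqs: "1 / b < (\<psi> (s + \<eta>) - \<psi> s) / \<eta>" "(\<psi> s - \<psi> (s - \<eta>)) / \<eta> < 1 / a"
      "(\<psi> s - \<psi> (s - \<eta>)) / \<eta> < (1 + \<kappa>) / b"
    using eventually_happens[of _ "at_right (0 :: real)"] by (auto simp: trivial_limit_at_right_real)
  define \<Delta> where "\<Delta> = \<psi> s - \<psi> (s - \<eta>)"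
  define \<Delta>' where "\<Delta>' = \<psi> (s + \<eta>) - \<psi> s"
  \<comment> \<open>\<open>r\<close>, \<open>r'\<close> and \<open>r''\<close> are the decay rates
    in \<open>t\<close> of the three error terms; each of the inequalities in \<open>ineqs\<close>
    makes one of them positive.\<close>
  define r where "r = \<eta> - a * \<Delta>"
  define r' where "r' = b * \<Delta>' - \<eta>"
  define r'' where "r'' = \<eta> * (1 + \<kappa>) - b * \<Delta>"
  have r: "0 < r" "0 < r'" "0 < r''"
    using ineqs x \<eta>(1) by (auto simp: r_def r'_def r''_def \<Delta>_def \<Delta>'_def field_simps)
  have "((\<lambda>t. exp (c - q * t)) \<longlongrightarrow> 0) at_top" if "0 < q" for c q :: real
    using that by real_asymp
  then have "((\<lambda>t. exp (\<bar>\<Delta>\<bar> - r * t) + exp (\<bar>\<Delta>'\<bar> - r' * t) + exp (\<bar>\<Delta>\<bar> - r'' * t)) \<longlongrightarrow> 0 + 0 + 0) at_top"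
    using r by (intro tendsto_add)
  then have "\<forall>\<^sub>F t in at_top. exp (\<bar>\<Delta>\<bar> - r * t) + exp (\<bar>\<Delta>'\<bar> - r' * t) + exp (\<bar>\<Delta>\<bar> - r'' * t) < 1 / 2"
    by (rule order_tendstoD) simp
  then have "\<forall>\<^sub>F t in at_top. ennreal (1 / 2 * exp (- \<bar>\<psi> s\<bar>)
        * exp (- ((b * \<psi> s - s + \<bar>s\<bar> * \<kappa>) * t)))
      \<le> emeasure M {\<omega>\<in>space M. Z t \<omega> \<in> G}"
    using eventually_gt_at_top[of 0]
  proof eventually_elim
    case (elim t)
    define n where "n = nat \<lceil>a * t\<rceil>"
    define m where "m = nat \<lceil>b * t\<rceil>"
    have pos: "0 < a * t" "0 < b * t" using x elim by auto
    have n: "a * t \<le> real n" "real n \<le> a * t + 1" and m: "b * t \<le> real m" "real m \<le> b * t + 1"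
      using pos unfolding n_def m_def by linarith+
    have "n \<le> m"
      using x elim unfolding n_def m_def
      by (intro nat_mono ceiling_mono mult_right_mono) auto
    \<comment> \<open>Rounding shifts each exponent by an amount bounded in
      \<open>t\<close>.\<close>
    have round: "real k * d \<le> c * d + \<bar>d\<bar>" if "c \<le> real k" "real k \<le> c + 1" for k c d
    proof -
      have "(real k - c) * d \<le> 1 * \<bar>d\<bar>"
        using that by (intro order_trans[OF mult_left_mono[OF abs_ge_self] mult_right_mono]) auto
      then show ?thesis by (simp add: algebra_simps)
    qed
    have "real n * \<Delta> - \<eta> * t \<le> \<bar>\<Delta>\<bar> - r * t"
      using round[OF n, of \<Delta>] by (simp add: r_def algebra_simps)
    moreover have "\<eta> * t - real m * \<Delta>' \<le> \<bar>\<Delta>'\<bar> - r' * t"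
      using round[OF m, of "- \<Delta>'"] by (simp add: r'_def algebra_simps)
    moreover have "real m * \<Delta> - \<eta> * (t * (1 + \<kappa>)) \<le> \<bar>\<Delta>\<bar> - r'' * t"
      using round[OF m, of \<Delta>] by (simp add: r''_def algebra_simps)
    ultimately have "exp (real n * \<Delta> - \<eta> * t) + exp (\<eta> * t - real m * \<Delta>')
        + exp (real m * \<Delta> - \<eta> * (t * (1 + \<kappa>)))
        \<le> exp (\<bar>\<Delta>\<bar> - r * t) + exp (\<bar>\<Delta>'\<bar> - r' * t) + exp (\<bar>\<Delta>\<bar> - r'' * t)"
      by (intro add_mono) auto
    then have *: "1 / 2 * exp (s * t - \<bar>s\<bar> * \<kappa> * t - real m * \<psi> s)
        \<le> measure M {\<omega>\<in>space M. S n \<omega> \<le> t \<and> t < S m \<omega>}"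
      using elim s interior_subset \<eta> \<kappa>(1) \<open>n \<le> m\<close> unfolding \<Delta>_def \<Delta>'_def
      by (intro prob_window_ge[of s \<eta> \<kappa> t n m]) auto
    have "- \<bar>\<psi> s\<bar> - (b * \<psi> s - s + \<bar>s\<bar> * \<kappa>) * t \<le> s * t - \<bar>s\<bar> * \<kappa> * t - real m * \<psi> s"
      using round[OF m, of "\<psi> s"] by (simp add: algebra_simps)
    then have "ennreal (1 / 2 * exp (- \<bar>\<psi> s\<bar>) * exp (- ((b * \<psi> s - s + \<bar>s\<bar> * \<kappa>) * t)))
        \<le> ennreal (1 / 2 * exp (s * t - \<bar>s\<bar> * \<kappa> * t - real m * \<psi> s))"
      by (intro ennreal_leI) (simp add: mult.assoc exp_add[symmetric])
    also have "\<dots> \<le> emeasure M {\<omega>\<in>space M. S n \<omega> \<le> t \<and> t < S m \<omega>}"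
      using * by (simp add: emeasure_eq_measure)
    also have "\<dots> \<le> emeasure M {\<omega>\<in>space M. Z t \<omega> \<in> G}"
    proof (rule emeasure_mono_AE)
      have "0 < b" using x by simp
      show "AE \<omega> in M. \<omega> \<in> {\<omega>\<in>space M. S n \<omega> \<le> t \<and> t < S m \<omega>} \<longrightarrow> \<omega> \<in> {\<omega>\<in>space M. Z t \<omega> \<in> G}"
        using AE_pos AE_space
        by eventually_elim
           (use Z_mem_if_S[OF _ \<open>0 < t\<close> \<open>0 < b\<close>, of _ a] G(1) in \<open>auto simp: n_def m_def\<close>)
    qed (use G(2) in measurable)
    finally show ?case .
  qed
  then show ?thesis
    unfolding \<kappa>_def[symmetric] by (rule Liminf_log_rate_ge[rotated]) simp
qed

text \<open>The local bound involves \<open>b\<close> but not \<open>a\<close>, so it remains to let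
  \<open>b\<close> decrease to \<open>x\<close> with \<open>{a..b}\<close> inside
  \<open>G\<close>.\<close>

lemma Liminf_point_ge:
  assumes x: "0 < x" and s: "s \<in> interior D" and deriv: "(\<psi> has_real_derivative 1 / x) (at s)"
    and G: "open G" "x \<in> G"
  shows "ereal (- (x * \<psi> s - s))
    \<le> Liminf at_top (\<lambda>t. ereal (1 / t) * elog (emeasure M {\<omega>\<in>space M. Z t \<omega> \<in> G}))"
    (is "_ \<le> ?L")
proof -
  obtain d where d: "0 < d" "cball x d \<subseteq> G"
    using G open_contains_cball by blast
  have lim: "((\<lambda>b. ereal (- (b * \<psi> s - s + \<bar>s\<bar> * (2 * (b - x) / x))))
      \<longlongrightarrow> ereal (- (x * \<psi> s - s + \<bar>s\<bar> * (2 * (x - x) / x)))) (at_right x)"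
    using x by (intro tendsto_intros) auto
  have ev: "\<forall>\<^sub>F b in at_right x. b \<in> {x<..<x + d}"
    using d(1) by (intro eventually_at_right_real) simp
  have le: "\<forall>\<^sub>F b in at_right x. ereal (- (b * \<psi> s - s + \<bar>s\<bar> * (2 * (b - x) / x))) \<le> ?L"
    using ev
  proof eventually_elim
    case (elim b)
    \<comment> \<open>The maximum keeps \<open>a\<close> positive and within distance
      \<open>d\<close> of \<open>x\<close>.\<close>
    define a where "a = max (x / 2) (x - d)"
    have "{a..b} \<subseteq> G"
      using elim d by (intro subset_trans[OF _ d(2)]) (auto simp: a_def dist_real_def)
    then show ?case
      using elim x d(1) G(1) s deriv
      by (intro Liminf_local_ge[of a x b s G]) (auto simp: a_def)
  qed
  show ?thesis
    using tendsto_upperbound[OF lim le] by simp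
qed


end

text \<open>
  The point \<open>x\<^sub>0\<close> is the law-of-large-numbers limit \<open>1 / E T\<^sub>1\<close> of \<open>Z\<close>; it is \<open>0\<close> when the mean is
  infinite. No tilt has slope \<open>1 / 0\<close>, so the lower bound at \<open>0\<close> is obtained from the points near it
  by means of \<open>boundary\<close>.
\<close>
locale renewal_ldp = renewal_process +
  fixes x\<^sub>0 :: real
  assumes zero_mem: "0 \<in> D"
    and sign: "s \<in> D \<Longrightarrow> 0 \<le> s \<Longrightarrow> 0 \<le> \<psi> s" "s \<in> D \<Longrightarrow> s \<le> 0 \<Longrightarrow> \<psi> s \<le> 0"
    and nondegenerate: "\<exists>s\<in>D. 0 \<le> s \<and> 0 < \<psi> s"
    and center: "0 \<le> x\<^sub>0" "s \<in> D \<Longrightarrow> x\<^sub>0 * \<psi> s \<le> s"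
    and slope: "0 < x \<Longrightarrow> \<exists>s\<in>interior D. (\<psi> has_real_derivative 1 / x) (at s)"
    and boundary: "(dual_rate D \<psi> \<longlongrightarrow> dual_rate D \<psi> 0) (at_right 0)"
begin

section \<open>Sublevel sets and the two bounds of the principle\<close>

abbreviation I :: "real \<Rightarrow> ereal" where "I \<equiv> dual_rate D \<psi>"

abbreviation P :: "real set \<Rightarrow> real \<Rightarrow> ennreal" where
  "P A t \<equiv> emeasure M {\<omega>\<in>space M. Z t \<omega> \<in> A}"

lemma I_nonneg: "0 \<le> I x"
proof (cases "x < 0")
  case False
  have "\<psi> 0 = 0" using sign[OF zero_mem] by simp
  with False dual_rate_ge[OF _ zero_mem, of x \<psi>] show ?thesis by (simp add: zero_ereal_def)
qed (simp add: dual_rate_def)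

lemma I_center: "I x\<^sub>0 \<le> 0"
  using center by (auto simp: dual_rate_def intro!: SUP_least)

lemma closed_sublevel: "closed {x. I x \<le> a}"
proof (cases "a = \<infinity>")
  case False
  then have "{x. I x \<le> a} = {0..} \<inter> (\<Inter>s\<in>D. {x. ereal (x * \<psi> s - s) \<le> a})"
    by (auto simp: dual_rate_def SUP_le_iff not_less split: if_splits)
  moreover have "closed {x. ereal (x * \<psi> s - s) \<le> a}" for s
    by (intro closed_Collect_le continuous_intros)
  ultimately show ?thesis
    by (simp only:) (intro closed_Int closed_INT ballI closed_atLeast)
qed simp

text \<open>One parameter with \<open>\<psi> s > 0\<close> bounds the rate function below by a line
  of positive slope.\<close>

lemma compact_sublevel: "compact {x. I x \<le> ereal \<eta>}"
proof -
  obtain s where s: "s \<in> D" "0 < \<psi> s" using nondegenerate by auto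
  have "{x. I x \<le> ereal \<eta>} \<subseteq> {0..(\<eta> + s) / \<psi> s}"
  proof
    fix x assume x: "x \<in> {x. I x \<le> ereal \<eta>}"
    then have "0 \<le> x" by (auto simp: dual_rate_def split: if_splits)
    with dual_rate_ge[OF this s(1), of \<psi>] x s(2) show "x \<in> {0..(\<eta> + s) / \<psi> s}"
      by (auto simp: field_simps dest: order_trans)
  qed
  then show ?thesis
    using closed_sublevel bounded_subset[OF bounded_closed_interval]
    by (auto simp: compact_eq_bounded_closed)
qed

text \<open>\<open>C\<close> contains its infimum \<open>b \<ge> x\<^sub>0\<close>. A parameter
  \<open>s < 0\<close> would give
  \<open>b * \<psi> s - s \<le> x\<^sub>0 * \<psi> s - s \<le> 0\<close>, so one whose value at
  \<open>b\<close> exceeds \<open>m \<ge> 0\<close> is nonnegative and \<open>upper_tail\<close>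
  applies.\<close>

lemma upper_tail_closed:
  assumes "closed C" "C \<subseteq> {x\<^sub>0..}" "0 \<le> m" "\<And>x. x \<in> C \<Longrightarrow> ereal m < I x" "0 < t"
  shows "P C t \<le> ennreal (exp (- (m * t)))"
proof (cases "C = {}")
  case False
  have bdd: "bdd_below C" using assms(2) by (intro bdd_belowI) auto
  define b where "b = Inf C"
  have b: "b \<in> C" unfolding b_def by (rule closed_contains_Inf[OF False bdd assms(1)])
  then have "x\<^sub>0 \<le> b" "ereal m < I b" using assms by auto
  then obtain s where s: "s \<in> D" "m < b * \<psi> s - s"
    using center(1) by (auto simp: dual_rate_def less_SUP_iff)
  have "0 < b" "0 \<le> s"
  proof -
    have "0 \<le> (b - x\<^sub>0) * - \<psi> s" if "s < 0"
      using sign(2)[of s] s(1) \<open>x\<^sub>0 \<le> b\<close> that by (intro mult_nonneg_nonneg) auto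
    then show "0 \<le> s"
      using s(2) center(2)[OF s(1)] assms(3) by (force simp: algebra_simps)
    show "0 < b"
    proof (rule ccontr)
      assume "\<not> 0 < b"
      then have "b = x\<^sub>0" using \<open>x\<^sub>0 \<le> b\<close> center(1) by simp
      with I_center \<open>ereal m < I b\<close> have "ereal m < 0" by (metis less_le_trans)
      then show False using assms(3) by simp
    qed
  qed
  have "P C t \<le> emeasure M {\<omega>\<in>space M. b \<le> Z t \<omega>}"
    using bdd by (intro emeasure_mono) (auto simp: b_def intro: cInf_lower)
  also have "\<dots> \<le> ennreal (exp (- ((b * \<psi> s - s) * t)))"
    using s \<open>0 < b\<close> \<open>0 \<le> s\<close> sign(1) assms(5) by (intro upper_tail) auto
  also have "\<dots> \<le> ennreal (exp (- (m * t)))"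
    using s(2) assms(5) by (intro ennreal_leI) auto
  finally show ?thesis .
qed simp

lemma renewal_count_finite: "AE \<omega> in M. renewal_count T t \<omega> \<noteq> \<infinity>"
  using nondegenerate AE_renewal_count_finite by blast

text \<open>The mirror image at the supremum of \<open>C\<close>, with a nonpositive parameter. If
  \<open>x\<^sub>0 = 0\<close>, then \<open>C\<close> is empty, because the rate at the centre is at
  most 0.\<close>

lemma lower_tail_closed:
  assumes "closed C" "C \<subseteq> {0..x\<^sub>0}" "0 \<le> m" "\<And>x. x \<in> C \<Longrightarrow> ereal m < I x"
  obtains K where "0 < K" "\<And>t. 0 < t \<Longrightarrow> P C t \<le> ennreal (K * exp (- (m * t)))"
proof (cases "C = {}")
  case True
  then show ?thesis using that[of 1] by simp
next
  case False
  have bdd: "bdd_above C" using assms(2) by (intro bdd_aboveI) auto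
  define a where "a = Sup C"
  have a: "a \<in> C" unfolding a_def by (rule closed_contains_Sup[OF False bdd assms(1)])
  then have "a \<le> x\<^sub>0" "0 \<le> a" "ereal m < I a" using assms by auto
  then obtain s where s: "s \<in> D" "m < a * \<psi> s - s"
    by (auto simp: dual_rate_def less_SUP_iff)
  have "s \<le> 0"
  proof -
    have "0 \<le> (x\<^sub>0 - a) * \<psi> s" if "0 < s"
      using sign(1)[of s] s(1) \<open>a \<le> x\<^sub>0\<close> that by (intro mult_nonneg_nonneg) auto
    then show ?thesis
      using s(2) center(2)[OF s(1)] assms(3) by (force simp: algebra_simps)
  qed
  show ?thesis
  proof (rule that[of "exp (- \<psi> s)"])
    fix t :: real assume t: "0 < t"
    have "P C t \<le> emeasure M {\<omega>\<in>space M. Z t \<omega> \<le> a}"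
      using bdd by (intro emeasure_mono) (auto simp: a_def intro: cSup_upper)
    also have "\<dots> \<le> ennreal (exp (- \<psi> s) * exp (- ((a * \<psi> s - s) * t)))"
      using s \<open>0 \<le> a\<close> \<open>s \<le> 0\<close> sign(2) t renewal_count_finite by (intro lower_tail) auto
    also have "\<dots> \<le> ennreal (exp (- \<psi> s) * exp (- (m * t)))"
      using s(2) t by (intro ennreal_leI) auto
    finally show "P C t \<le> ennreal (exp (- \<psi> s) * exp (- (m * t)))" .
  qed simp
qed

text \<open>Working with real \<open>m\<close> below the infimum covers an infinite infimum too. For
  \<open>m < 0\<close> the bound is trivial; otherwise \<open>C\<close> is split at
  \<open>x\<^sub>0\<close>, and a sum of two exponentials has the same rate.\<close>

lemma Limsup_closed:
  assumes "closed C"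
  shows "Limsup at_top (\<lambda>t. ereal (1 / t) * elog (P C t)) \<le> - (INF x\<in>C. I x)"
proof -
  have *: "Limsup at_top (\<lambda>t. ereal (1 / t) * elog (P C t)) \<le> ereal (- m)"
    if m: "ereal m < (INF x\<in>C. I x)" for m
  proof (cases "0 \<le> m")
    case False
    have "P C t \<le> ennreal (1 * exp (- (m * t)))" if "0 < t" for t
    proof -
      have "P C t \<le> 1" by (rule emeasure_le_1)
      also have "\<dots> \<le> ennreal (exp (- (m * t)))"
        using False that by (simp add: mult_le_0_iff)
      finally show ?thesis by simp
    qed
    then show ?thesis by (intro Limsup_log_rate_le[of 1]) auto
  next
    case True
    have IC: "ereal m < I x" if "x \<in> C" for x
      using m that by (auto dest: less_INF_D)
    have cl: "closed (C \<inter> {0..x\<^sub>0})" "closed (C \<inter> {x\<^sub>0..})"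
      using assms by (auto intro!: closed_Int)
    obtain K where K: "0 < K" "\<And>t. 0 < t \<Longrightarrow> P (C \<inter> {0..x\<^sub>0}) t \<le> ennreal (K * exp (- (m * t)))"
      using lower_tail_closed[OF cl(1) _ True] IC by auto
    have "P C t \<le> ennreal ((K + 1) * exp (- (m * t)))" if "0 < t" for t
    proof -
      have [measurable]: "C \<in> sets borel" using assms by auto
      have "P C t \<le> emeasure M ({\<omega>\<in>space M. Z t \<omega> \<in> C \<inter> {0..x\<^sub>0}} \<union> {\<omega>\<in>space M. Z t \<omega> \<in> C \<inter> {x\<^sub>0..}})"
        using Z_nonneg[OF that] by (intro emeasure_mono) (auto simp: not_le)
      also have "\<dots> \<le> P (C \<inter> {0..x\<^sub>0}) t + P (C \<inter> {x\<^sub>0..}) t"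
        by (intro emeasure_subadditive) auto
      also have "\<dots> \<le> ennreal (K * exp (- (m * t))) + ennreal (exp (- (m * t)))"
        using IC that by (intro add_mono K upper_tail_closed[OF cl(2) _ True]) auto
      also have "\<dots> = ennreal ((K + 1) * exp (- (m * t)))"
        using K(1) by (simp add: ennreal_plus[symmetric] algebra_simps del: ennreal_plus)
      finally show ?thesis .
    qed
    then show ?thesis using K(1) by (intro Limsup_log_rate_le[of "K + 1"]) auto
  qed
  show ?thesis
  proof (rule ccontr)
    assume "\<not> ?thesis"
    then have "- Limsup at_top (\<lambda>t. ereal (1 / t) * elog (P C t)) < (INF x\<in>C. I x)"
      by (simp add: ereal_uminus_less_reorder not_le)
    then obtain m where "- Limsup at_top (\<lambda>t. ereal (1 / t) * elog (P C t)) < ereal m"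
      "ereal m < (INF x\<in>C. I x)"
      using ereal_dense2 by blast
    with *[of m] show False
      by (cases "Limsup at_top (\<lambda>t. ereal (1 / t) * elog (P C t))") auto
  qed
qed

lemma Liminf_open:
  assumes "open G"
  shows "- (INF x\<in>G. I x) \<le> Liminf at_top (\<lambda>t. ereal (1 / t) * elog (P G t))" (is "_ \<le> ?L")
proof -
  have pos: "- I x \<le> ?L" if "x \<in> G" "0 < x" for x
  proof -
    obtain s where s: "s \<in> interior D" "(\<psi> has_real_derivative 1 / x) (at s)"
      using slope \<open>0 < x\<close> by blast
    \<comment> \<open>The exponent of the tilted bound is one of the values in the supremum, which
      is the direction needed here.\<close>
    then have "ereal (x * \<psi> s - s) \<le> I x"
      using interior_subset that by (intro dual_rate_ge) auto
    then have "- I x \<le> ereal (- (x * \<psi> s - s))"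
      by (metis ereal_minus_le_minus uminus_ereal.simps(1))
    also have "\<dots> \<le> ?L"
      using Liminf_point_ge[OF \<open>0 < x\<close> s assms \<open>x \<in> G\<close>] .
    finally show ?thesis .
  qed
  have "- I x \<le> ?L" if x: "x \<in> G" for x
  proof -
    consider "x < 0" | "x = 0" | "0 < x" by linarith
    then show ?thesis
    proof cases
      case 1
      then show ?thesis by (simp add: dual_rate_def)
    next
      case 2
      have "\<forall>\<^sub>F y in at_right 0. y \<in> G"
        using assms x 2 by (auto intro!: eventually_at_topological[THEN iffD2])
      then have "\<forall>\<^sub>F y in at_right 0. - I y \<le> ?L"
        using eventually_at_right_less[of 0] by eventually_elim (rule pos)
      then show ?thesis
        using boundary unfolding 2
        by (intro tendsto_upperbound[of "\<lambda>y. - I y" _ "at_right 0"]) (auto simp: tendsto_uminus_ereal)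
    next
      case 3
      then show ?thesis using pos x by blast
    qed
  qed
  then have "- ?L \<le> (INF x\<in>G. I x)"
    by (intro INF_greatest) (simp add: ereal_uminus_le_reorder)
  then show ?thesis by (simp add: ereal_uminus_le_reorder)
qed

theorem LDP: "satisfies_LDP M (\<lambda>t \<omega>. enn2real (renewal_count T t \<omega>) / t) I"
  unfolding satisfies_LDP_def lower_semicontinuous_def
  using I_nonneg closed_sublevel Limsup_closed Liminf_open measurable_Z
  by (auto simp: Z_def[abs_def])

lemma good_rate_I: "good_rate I"
  using compact_sublevel by (auto simp: good_rate_def)

end

section \<open>The exponent and the rate function of the Mittag-Leffler waiting times\<close>

text \<open>For \<nu> = 1 the domain contains negative \<open>s\<close>, where
  \<open>s powr 1\<close> is not \<open>s\<close>; hence the case distinction.\<close>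

definition laplace_exponent :: "real \<Rightarrow> real \<Rightarrow> real \<Rightarrow> real \<Rightarrow> real" where
  "laplace_exponent \<nu> h l s = h * ln (1 + (if \<nu> = 1 then s else s powr \<nu>) / l)"

definition laplace_domain :: "real \<Rightarrow> real \<Rightarrow> real set" where
  "laplace_domain \<nu> l = (if \<nu> = 1 then {- l<..} else {0..})"

text \<open>The principal power multiplies the argument by \<open>\<nu> \<le> 1\<close>, so the
  right half-plane is mapped into itself. This keeps \<open>1 + z powr \<nu> / l\<close> off the
  branch cut of \<open>Ln\<close>.\<close>

lemma Re_powr_pos:
  assumes "0 < Re z" "0 < \<nu>" "\<nu> \<le> 1"
  shows "0 < Re (z powr of_real \<nu>)"
proof -
  have "z \<noteq> 0" using assms(1) by auto
  then have "\<bar>Im (Ln z)\<bar> < pi / 2" using assms(1) Re_Ln_pos_lt by blast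
  then have "\<bar>\<nu> * Im (Ln z)\<bar> < pi / 2"
    using assms(2,3) mult_left_le_one_le[of "\<bar>Im (Ln z)\<bar>" \<nu>] by (simp add: abs_mult)
  then have "0 < cos (\<nu> * Im (Ln z))" by (intro cos_gt_zero_pi) auto
  then show ?thesis using \<open>z \<noteq> 0\<close> by (simp add: powr_def Re_exp)
qed

context
  fixes \<nu> h l :: real
  assumes \<nu>: "0 < \<nu>" "\<nu> \<le> 1" and h: "0 < h" and l: "0 < l"
begin

private abbreviation "\<psi> \<equiv> laplace_exponent \<nu> h l"
private abbreviation "D \<equiv> laplace_domain \<nu> l"

lemma laplace_exponent_one: "\<nu> = 1 \<Longrightarrow> \<psi> s = h * ln (1 + s / l)"
  and laplace_exponent_less_one: "\<nu> < 1 \<Longrightarrow> \<psi> s = h * ln (1 + s powr \<nu> / l)"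
  by (simp_all add: laplace_exponent_def)

lemma exp_minus_laplace_exponent:
  assumes "0 < s"
  shows "exp (- \<psi> s) = (1 + s powr \<nu> / l) powr - h"
proof -
  have "0 < 1 + s powr \<nu> / l" using l by (simp add: add_pos_nonneg)
  moreover have "(if \<nu> = 1 then s else s powr \<nu>) = s powr \<nu>" using assms by simp
  moreover have "y powr - h = exp (- (h * ln y))" if "0 < y" for y :: real
    using that by (simp add: powr_def)
  ultimately show ?thesis by (simp only: laplace_exponent_def)
qed

lemma laplace_waiting_density:
  assumes M: "prob_space M" and X: "has_real_density M X (waiting_density \<nu> h l)" and s: "s \<in> D"
  shows "(\<integral>\<^sup>+\<omega>. ennreal (exp (- (s * X \<omega>))) \<partial>M) = ennreal (exp (- \<psi> s))"
proof -
  have meas: "X \<in> borel_measurable M"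
    using X distributed_measurable by (fastforce simp: has_real_density_def)
  have pos: "AE \<omega> in M. 0 \<le> X \<omega>"
    using AE_pos_if_waiting_density[OF X] by eventually_elim simp
  \<comment> \<open>The margin 2 keeps \<open>s\<^sub>0 - u\<close> above the threshold
    \<open>l powr (1 / \<nu>)\<close> for all \<open>u \<le> 1\<close>, and makes the radius of the
    disc exceed 1.\<close>
  define s\<^sub>0 where "s\<^sub>0 = max s (l powr (1 / \<nu>)) + 2"
  have large: "(\<integral>\<^sup>+\<omega>. ennreal (exp (- ((s\<^sub>0 - u) * X \<omega>))) \<partial>M) = ennreal (exp (- \<psi> (s\<^sub>0 - u)))"
    if "0 \<le> u" "u \<le> 1" for u
  proof -
    have gt: "l powr (1 / \<nu>) < s\<^sub>0 - u" using that by (simp add: s\<^sub>0_def)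
    then have p: "0 < s\<^sub>0 - u" by (rule le_less_trans[rotated]) simp
    have "(l powr (1 / \<nu>)) powr \<nu> < (s\<^sub>0 - u) powr \<nu>"
      using gt \<nu> by (intro powr_less_mono2) auto
    then have "l < (s\<^sub>0 - u) powr \<nu>" using l \<nu> by (simp add: powr_powr)
    from laplace_waiting_density_large[OF \<nu>(1) h l p this X] show ?thesis
      by (simp only: exp_minus_laplace_exponent[OF p])
  qed
  have s\<^sub>0: "2 \<le> s\<^sub>0" "s < s\<^sub>0"
    using order_trans[OF powr_ge_zero[of l "1 / \<nu>"] max.cobounded2[of _ s]] by (auto simp: s\<^sub>0_def)
  show ?thesis
  proof (cases "\<nu> = 1")
    case True
    define G where "G z = exp (- of_real h * Ln (1 + z / of_real l))" for z
    \<comment> \<open>The disc reaches down to the singularity at \<open>- l\<close>, the left end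
      of \<open>D\<close>.\<close>
    have "0 < Re (1 + z / of_real l)" if "z \<in> ball (of_real s\<^sub>0) (s\<^sub>0 + l)" for z
    proof -
      have "\<bar>s\<^sub>0 - Re z\<bar> < s\<^sub>0 + l"
        using that abs_Re_le_cmod[of "of_real s\<^sub>0 - z"] by (simp add: dist_norm)
      then show ?thesis using l by (simp add: Re_divide_of_real field_simps)
    qed
    then have hol: "G holomorphic_on ball (of_real s\<^sub>0) (s\<^sub>0 + l)"
      unfolding G_def[abs_def] using l
      by (intro holomorphic_intros) (force simp: complex_nonpos_Reals_iff)+
    have G: "G (of_real (s\<^sub>0 - u)) = of_real (exp (- \<psi> (s\<^sub>0 - u)))"
      if "0 \<le> u" "u < s\<^sub>0 + l" for u
    proof -
      have p: "0 < 1 + (s\<^sub>0 - u) / l" using that l by (simp add: field_simps)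
      have "1 + complex_of_real (s\<^sub>0 - u) / of_real l = of_real (1 + (s\<^sub>0 - u) / l)" by simp
      then show ?thesis
        unfolding G_def Ln_of_real[OF p] laplace_exponent_one[OF True]
        by (simp only: Ln_of_real[OF p] exp_of_real[symmetric] of_real_minus of_real_mult mult_minus_left)
    qed
    have "(\<integral>\<^sup>+\<omega>. ennreal (exp (- ((s\<^sub>0 - (s\<^sub>0 - s)) * X \<omega>))) \<partial>M) = ennreal (exp (- \<psi> (s\<^sub>0 - (s\<^sub>0 - s))))"
    proof (rule laplace_extend[OF meas pos hol G _ zero_less_one _ large])
      show "0 \<le> s\<^sub>0 - s" "1 < s\<^sub>0 + l" using s\<^sub>0 l by auto
      show "s\<^sub>0 - s < s\<^sub>0 + l" using s True by (simp add: laplace_domain_def)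
    qed simp_all
    then show ?thesis by simp
  next
    case False
    then have s_nonneg: "0 \<le> s" using s by (simp add: laplace_domain_def)
    \<comment> \<open>The branch point of the power restricts the radius to
      \<open>s\<^sub>0\<close>, so \<open>s = 0\<close> lies on the boundary of the disc; there the
      transform is the total mass.\<close>
    show ?thesis
    proof (cases "s = 0")
      case True
      then show ?thesis
        using prob_space.emeasure_space_1[OF M] \<nu> False by (simp add: laplace_exponent_def)
    next
      case s_nz: False
      define G where "G z = exp (- of_real h * Ln (1 + z powr of_real \<nu> / of_real l))" for z
      have ball: "0 < Re z" if "z \<in> ball (of_real s\<^sub>0) s\<^sub>0" for z
        using that abs_Re_le_cmod[of "of_real s\<^sub>0 - z"] by (simp add: dist_norm)
      have "0 < Re (1 + z powr of_real \<nu> / of_real l)" if "z \<in> ball (of_real s\<^sub>0) s\<^sub>0" for z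
        using Re_powr_pos[OF ball[OF that] \<nu>] l by (simp add: Re_divide_of_real add_pos_pos)
      then have hol: "G holomorphic_on ball (of_real s\<^sub>0) s\<^sub>0"
        unfolding G_def[abs_def] using l ball
        by (intro holomorphic_intros) (force simp: complex_nonpos_Reals_iff)+
      have G: "G (of_real (s\<^sub>0 - u)) = of_real (exp (- \<psi> (s\<^sub>0 - u)))"
        if "0 \<le> u" "u < s\<^sub>0" for u
      proof -
        have p: "0 < 1 + (s\<^sub>0 - u) powr \<nu> / l" using l by (simp add: add_pos_nonneg)
        have "1 + complex_of_real (s\<^sub>0 - u) powr of_real \<nu> / of_real l = of_real (1 + (s\<^sub>0 - u) powr \<nu> / l)"
          using that by (simp add: powr_of_real del: of_real_diff)
        then show ?thesis
          unfolding G_def laplace_exponent_def using False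
          by (simp only: Ln_of_real[OF p] exp_of_real[symmetric] of_real_minus of_real_mult mult_minus_left if_False)
      qed
      have "(\<integral>\<^sup>+\<omega>. ennreal (exp (- ((s\<^sub>0 - (s\<^sub>0 - s)) * X \<omega>))) \<partial>M) = ennreal (exp (- \<psi> (s\<^sub>0 - (s\<^sub>0 - s))))"
        using s_nonneg s_nz s\<^sub>0
        by (intro laplace_extend[OF meas pos hol G _ zero_less_one _ large]) simp_all
      then show ?thesis by simp
    qed
  qed
qed

text \<open>For \<nu> = 1 the transform is monotone and blows up at \<open>- l\<close>. For \<nu> <
  1 a finite value at some \<open>s < 0\<close> would bound
  \<open>(1 - exp (- \<psi> r)) / r\<close> for all \<open>r > 0\<close>, but this quotient behaves
  like a multiple of \<open>r powr (\<nu> - 1)\<close> near 0.\<close>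

lemma laplace_waiting_density_infinite:
  assumes M: "prob_space M" and X: "has_real_density M X (waiting_density \<nu> h l)" and s: "s \<notin> D"
  shows "(\<integral>\<^sup>+\<omega>. ennreal (exp (- (s * X \<omega>))) \<partial>M) = \<infinity>"
proof -
  have [measurable]: "X \<in> borel_measurable M"
    using X distributed_measurable by (fastforce simp: has_real_density_def)
  have pos: "AE \<omega> in M. 0 < X \<omega>" by (rule AE_pos_if_waiting_density[OF X])
  show ?thesis
  proof (cases "\<nu> = 1")
    case True
    have le: "ennreal (exp (- \<psi> r)) \<le> (\<integral>\<^sup>+\<omega>. ennreal (exp (- (s * X \<omega>))) \<partial>M)" if "- l < r" for r
    proof -
      have r: "r \<in> D" "s \<le> r" using True s that by (auto simp: laplace_domain_def)
      have "(\<integral>\<^sup>+\<omega>. ennreal (exp (- (r * X \<omega>))) \<partial>M) \<le> (\<integral>\<^sup>+\<omega>. ennreal (exp (- (s * X \<omega>))) \<partial>M)"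
        using pos by (intro nn_integral_mono_AE) (auto intro!: ennreal_leI mult_right_mono r(2) elim!: eventually_mono)
      then show ?thesis using laplace_waiting_density[OF M X r(1)] by simp
    qed
    have "filterlim (\<lambda>r. exp (- (h * ln (1 + r / l)))) at_top (at_right (- l))"
      using l h by real_asymp
    then have "((\<lambda>r. ennreal (exp (- \<psi> r))) \<longlongrightarrow> \<infinity>) (at_right (- l))"
      unfolding laplace_exponent_one[OF True] by (auto simp: ennreal_tendsto_top_eq_at_top)
    then have "\<infinity> \<le> (\<integral>\<^sup>+\<omega>. ennreal (exp (- (s * X \<omega>))) \<partial>M)"
      by (rule tendsto_upperbound)
         (use le in \<open>auto intro: eventually_mono[OF eventually_at_right_less]\<close>)
    then show ?thesis by (simp add: top_unique)
  next
    case False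
    then have "\<nu> < 1" "s < 0" using s \<nu> by (auto simp: laplace_domain_def)
    show ?thesis
    proof (rule ccontr)
      assume "(\<integral>\<^sup>+\<omega>. ennreal (exp (- (s * X \<omega>))) \<partial>M) \<noteq> \<infinity>"
      then obtain c where c: "0 \<le> c" "(\<integral>\<^sup>+\<omega>. ennreal (exp (- (s * X \<omega>))) \<partial>M) = ennreal c"
        by (cases "\<integral>\<^sup>+\<omega>. ennreal (exp (- (s * X \<omega>))) \<partial>M") auto
      have le: "(1 - (1 + r powr \<nu> / l) powr - h) / r \<le> c / - s" if "0 < r" for r
      proof -
        \<comment> \<open>With this \<open>q\<close>, pointwise
          \<open>1 - exp (- r X) \<le> r X = q (- s X) \<le> q exp (- s X)\<close>.\<close>
        define q where "q = r / - s"
        have q: "0 < q" "r = q * - s"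
          using that \<open>s < 0\<close> by (auto simp: q_def field_simps)
        have "ennreal 1 = (\<integral>\<^sup>+\<omega>. ennreal 1 \<partial>M)"
          by (simp add: prob_space.emeasure_space_1[OF M])
        also have "\<dots> \<le> (\<integral>\<^sup>+\<omega>. ennreal (exp (- (r * X \<omega>))) + ennreal q * ennreal (exp (- (s * X \<omega>))) \<partial>M)"
        proof (rule nn_integral_mono)
          fix \<omega>
          have "1 \<le> exp (- (r * X \<omega>)) + q * (- (s * X \<omega>))"
          proof -
            have "q * (- (s * X \<omega>)) = r * X \<omega>" by (simp add: q(2))
            then show ?thesis using exp_ge_add_one_self[of "- (r * X \<omega>)"] by linarith
          qed
          also have "\<dots> \<le> exp (- (r * X \<omega>)) + q * exp (- (s * X \<omega>))"
            using q(1) exp_ge_add_one_self[of "- (s * X \<omega>)"]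
            by (intro add_left_mono mult_left_mono) linarith+
          finally have "ennreal 1 \<le> ennreal (exp (- (r * X \<omega>)) + q * exp (- (s * X \<omega>)))"
            by (rule ennreal_leI)
          then show "ennreal 1 \<le> ennreal (exp (- (r * X \<omega>))) + ennreal q * ennreal (exp (- (s * X \<omega>)))"
            using q(1) by (simp add: ennreal_mult')
        qed
        also have "\<dots> = ennreal (exp (- \<psi> r)) + ennreal q * ennreal c"
          using that False by (simp add: nn_integral_add nn_integral_cmult c
            laplace_waiting_density[OF M X] laplace_domain_def)
        also have "\<dots> = ennreal (exp (- \<psi> r) + q * c)"
          using q(1) c(1) by (simp add: ennreal_mult')
        finally have "1 \<le> exp (- \<psi> r) + q * c"
          using q(1) c(1) by (subst (asm) ennreal_le_iff) auto
        then show ?thesis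
          using that \<open>s < 0\<close> unfolding exp_minus_laplace_exponent[OF that] q_def
          by (simp add: field_simps)
      qed
      have "filterlim (\<lambda>r. (1 - (1 + r powr \<nu> / l) powr - h) / r) at_top (at_right 0)"
        using \<nu> h l \<open>\<nu> < 1\<close> by real_asymp
      then have "\<forall>\<^sub>F r in at_right 0. c / - s < (1 - (1 + r powr \<nu> / l) powr - h) / r"
        by (simp add: filterlim_at_top_dense)
      then have "\<forall>\<^sub>F r in at_right (0::real). False"
        using eventually_at_right_less[of 0] by eventually_elim (use le in force)
      then show False by simp
    qed
  qed
qed


section \<open>Identification of the rate function\<close>

lemma log_mgf_waiting_density:
  assumes M: "prob_space M" and X: "has_real_density M X (waiting_density \<nu> h l)"
  shows "log_mgf M X \<theta> = (if - \<theta> \<in> D then ereal (- \<psi> (- \<theta>)) else \<infinity>)"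
  using laplace_waiting_density[OF M X, of "- \<theta>"] laplace_waiting_density_infinite[OF M X, of "- \<theta>"]
  by (simp add: log_mgf_def elog_ennreal) (simp add: elog_def)

lemma cramer_rate_waiting_density:
  assumes M: "prob_space M" and X: "has_real_density M X (waiting_density \<nu> h l)"
  shows "cramer_rate M X x = (SUP s\<in>D. ereal (\<psi> s - s * x))"
  unfolding cramer_rate_def
proof (rule antisym)
  show "(SUP \<theta>. ereal (\<theta> * x) - log_mgf M X \<theta>) \<le> (SUP s\<in>D. ereal (\<psi> s - s * x))"
  proof (rule SUP_least)
    fix \<theta>
    show "ereal (\<theta> * x) - log_mgf M X \<theta> \<le> (SUP s\<in>D. ereal (\<psi> s - s * x))"
    proof (cases "- \<theta> \<in> D")
      case True
      then show ?thesis
        by (intro SUP_upper2[OF True]) (simp add: log_mgf_waiting_density[OF M X])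
    qed (simp add: log_mgf_waiting_density[OF M X])
  qed
  show "(SUP s\<in>D. ereal (\<psi> s - s * x)) \<le> (SUP \<theta>. ereal (\<theta> * x) - log_mgf M X \<theta>)"
  proof (rule SUP_least)
    fix s assume "s \<in> D"
    then show "ereal (\<psi> s - s * x) \<le> (SUP \<theta>. ereal (\<theta> * x) - log_mgf M X \<theta>)"
      by (intro SUP_upper2[of "- s"]) (simp_all add: log_mgf_waiting_density[OF M X])
  qed
qed

lemma zero_mem_domain: "0 \<in> D"
  using l by (simp add: laplace_domain_def)

text \<open>The value is minus the left end point of \<open>D\<close>, which is where the indicator
  of \<nu> = 1 comes from. For \<nu> = 1 the supremum is not attained, since \<open>D\<close> is
  open.\<close>

lemma dual_rate_zero: "dual_rate D \<psi> 0 = (if \<nu> = 1 then ereal l else 0)"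
proof (cases "\<nu> = 1")
  case True
  have "(SUP s\<in>D. ereal (- s)) = ereal l"
  proof (rule antisym)
    show "(SUP s\<in>D. ereal (- s)) \<le> ereal l"
      using True by (intro SUP_least) (auto simp: laplace_domain_def)
    show "ereal l \<le> (SUP s\<in>D. ereal (- s))"
    proof (rule dense_le)
      fix y assume "y < ereal l"
      then obtain r where "y < ereal r" "r < l" using ereal_dense2 by force
      then show "y \<le> (SUP s\<in>D. ereal (- s))"
        using True by (intro SUP_upper2[of "- r"]) (auto simp: laplace_domain_def)
    qed
  qed
  then show ?thesis using True by (simp add: dual_rate_def)
next
  case False
  have "(SUP s\<in>D. ereal (- s)) = 0"
    using False by (intro antisym SUP_least SUP_upper2[of 0]) (auto simp: laplace_domain_def)
  then show ?thesis using False by (simp add: dual_rate_def)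
qed

lemma renewal_rate_eq_dual_rate:
  assumes M: "prob_space M" and X: "has_real_density M X (waiting_density \<nu> h l)"
  shows "renewal_rate \<nu> l (cramer_rate M X) = dual_rate D \<psi>"
proof
  fix x :: real
  show "renewal_rate \<nu> l (cramer_rate M X) x = dual_rate D \<psi> x"
  proof (cases "0 < x")
    case True
    have "ereal x * cramer_rate M X (1 / x) = (SUP s\<in>D. ereal x * ereal (\<psi> s - s * (1 / x)))"
      unfolding cramer_rate_waiting_density[OF M X]
      using True zero_mem_domain by (intro Sup_ereal_mult_left') auto
    also have "\<dots> = (SUP s\<in>D. ereal (x * \<psi> s - s))"
      using True by (intro SUP_cong) (auto simp: algebra_simps)
    finally show ?thesis using True by (simp add: renewal_rate_def dual_rate_def)
  next
    case False
    then show ?thesis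
      using dual_rate_zero by (cases "x = 0") (auto simp: renewal_rate_def dual_rate_def)
  qed
qed

text \<open>This is the weighted inequality of arithmetic and geometric means multiplied by
  \<open>s powr (\<nu> - 1)\<close>; in this form it covers \<open>u = 0\<close> as well.\<close>

lemma powr_tangent:
  assumes "0 < s" "0 \<le> u"
  shows "u powr \<nu> \<le> s powr \<nu> + \<nu> * s powr (\<nu> - 1) * (u - s)"
proof -
  have "u powr \<nu> * s powr (1 - \<nu>) \<le> \<nu> * u + (1 - \<nu>) * s"
  proof (cases "u = 0")
    case False
    then show ?thesis using \<nu> assms by (intro Youngs_inequality_0) auto
  qed (use \<nu> assms in auto)
  then have "s powr (\<nu> - 1) * (u powr \<nu> * s powr (1 - \<nu>)) \<le> s powr (\<nu> - 1) * (\<nu> * u + (1 - \<nu>) * s)"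
    by (intro mult_left_mono) auto
  moreover have "s powr (\<nu> - 1) * s powr (1 - \<nu>) = 1" "s powr (\<nu> - 1) * s = s powr \<nu>"
    using assms(1) by (simp_all add: powr_add[symmetric] powr_diff)
  ultimately show ?thesis by (simp add: algebra_simps)
qed

lemma ln_tangent: "0 < y \<Longrightarrow> 0 < z \<Longrightarrow> ln z \<le> ln y + (z - y) / y" for y z :: real
  using ln_le_minus_one[of "z / y"] by (simp add: ln_div field_simps)

text \<open>
  Every slope \<open>1 / x\<close> of the concave function \<open>\<psi>\<close> is attained; for \<open>\<nu> < 1\<close> the point is only given
  implicitly, and the bound on it controls the rate function near \<open>0\<close>.
\<close>
lemma slope_attained:
  assumes x: "0 < x"
  obtains s where "s \<in> interior D" "(\<psi> has_real_derivative 1 / x) (at s)"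
    "dual_rate D \<psi> x = ereal (x * \<psi> s - s)"
    "\<nu> = 1 \<Longrightarrow> s = h * x - l" "\<nu> < 1 \<Longrightarrow> 0 < s \<and> s \<le> h * \<nu> * x"
proof -
  \<comment> \<open>A line of slope \<open>1 / x\<close> that touches \<open>\<psi>\<close> at
    \<open>s\<close> and lies above it makes \<open>s\<close> a maximiser of
    \<open>x * \<psi> u - u\<close>.\<close>
  have attained: "dual_rate D \<psi> x = ereal (x * \<psi> s - s)"
    if s: "s \<in> D" and tangent: "\<And>u. u \<in> D \<Longrightarrow> \<psi> u \<le> \<psi> s + (u - s) / x" for s
  proof -
    have "x * \<psi> u - u \<le> x * \<psi> s - s" if "u \<in> D" for u
      using tangent[OF that] x by (simp add: field_simps)
    then have "(SUP u\<in>D. ereal (x * \<psi> u - u)) \<le> ereal (x * \<psi> s - s)"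
      by (intro SUP_least) simp
    then show ?thesis
      using dual_rate_ge[of x s D \<psi>] s x by (simp add: dual_rate_def antisym)
  qed
  show thesis
  proof (cases "\<nu> = 1")
    case True
    \<comment> \<open>The solution of \<open>h / (l + s) = 1 / x\<close>.\<close>
    define s where "s = h * x - l"
    have ls: "l + s = h * x" "0 < l + s" using h x by (auto simp: s_def)
    have \<psi>: "\<psi> = (\<lambda>s. h * ln (1 + s / l))"
      by (simp add: fun_eq_iff laplace_exponent_one[OF True])
    have p: "0 < 1 + u / l" if "u \<in> D" for u
      using that l True by (simp add: laplace_domain_def field_simps)
    have sD: "s \<in> D" using True ls by (simp add: laplace_domain_def)
    have "D = {- l<..}" using True by (simp add: laplace_domain_def)
    then have "s \<in> interior D" using sD by (simp add: interior_open)
    moreover have "(\<psi> has_real_derivative 1 / x) (at s)"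
      unfolding \<psi> using p[OF sD] l h x ls
      by (auto intro!: derivative_eq_intros simp: field_simps)
    moreover have "dual_rate D \<psi> x = ereal (x * \<psi> s - s)"
    proof (rule attained[OF sD])
      fix u assume u: "u \<in> D"
      have "h * ln (1 + u / l) \<le> h * (ln (1 + s / l) + (1 + u / l - (1 + s / l)) / (1 + s / l))"
        using h p u sD by (intro mult_left_mono ln_tangent) auto
      also have "(1 + u / l - (1 + s / l)) / (1 + s / l) = (u - s) / (l + s)"
      proof -
        have "1 + u / l - (1 + s / l) = (u - s) / l" "1 + s / l = (l + s) / l"
          using l by (auto simp: field_simps)
        then show ?thesis using l by simp
      qed
      also have "h * (ln (1 + s / l) + (u - s) / (l + s)) = h * ln (1 + s / l) + (u - s) / x"
        using h by (simp add: ls(1) distrib_left)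
      finally show "\<psi> u \<le> \<psi> s + (u - s) / x"
        unfolding \<psi> .
    qed
    ultimately show thesis using that True by (simp add: s_def)
  next
    case False
    then have \<nu>1: "\<nu> < 1" using \<nu> by simp
    \<comment> \<open>\<open>f\<close> is the reciprocal of the derivative of \<open>\<psi>\<close>
      for \<open>s > 0\<close>. Dropping its first term leaves \<open>s / (h * \<nu>)\<close>,
      whence the right end point \<open>h * \<nu> * x\<close> of the search interval.\<close>
    define f where "f s = (l * s powr (1 - \<nu>) + s) / (h * \<nu>)" for s
    have "\<exists>s\<ge>0. s \<le> h * \<nu> * x \<and> f s = x"
    proof (rule IVT')
      show "f 0 \<le> x" using x by (simp add: f_def)
      show "x \<le> f (h * \<nu> * x)" using h \<nu> l by (simp add: f_def field_simps)
      show "continuous_on {0..h * \<nu> * x} f"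
        unfolding f_def[abs_def] using \<nu>1 h \<nu> by (intro continuous_intros continuous_on_powr') auto
    qed (use h \<nu> x in auto)
    then obtain s where s: "0 \<le> s" "s \<le> h * \<nu> * x" "f s = x" by auto
    have "s \<noteq> 0" using s(3) x by (auto simp: f_def)
    with s(1) have s0: "0 < s" by simp
    have x_eq: "h * (\<nu> * s powr (\<nu> - 1) / (l + s powr \<nu>)) = 1 / x"
    proof -
      have "s powr (1 - \<nu>) * s powr \<nu> = s"
        using s0 by (simp add: powr_add[symmetric])
      then have "s powr (1 - \<nu>) * (l + s powr \<nu>) = l * s powr (1 - \<nu>) + s"
        by (simp add: algebra_simps)
      then have "x = s powr (1 - \<nu>) * (l + s powr \<nu>) / (h * \<nu>)"
        using s(3) by (simp add: f_def)
      then have "h * \<nu> * s powr (\<nu> - 1) * x = (s powr (\<nu> - 1) * s powr (1 - \<nu>)) * (l + s powr \<nu>)"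
        using h \<nu> by simp
      also have "s powr (\<nu> - 1) * s powr (1 - \<nu>) = 1"
        using s0 by (simp add: powr_add[symmetric])
      finally have *: "h * \<nu> * s powr (\<nu> - 1) * x = l + s powr \<nu>" by simp
      have "0 < l + s powr \<nu>" using l by (simp add: add_pos_nonneg)
      then show ?thesis using x * by (simp add: divide_eq_eq eq_divide_eq mult.assoc)
    qed
    have \<psi>: "\<psi> = (\<lambda>s. h * ln (1 + s powr \<nu> / l))"
      by (simp add: fun_eq_iff laplace_exponent_less_one[OF \<nu>1])
    have p: "0 < 1 + u powr \<nu> / l" "0 < l + u powr \<nu>" for u
      using l by (auto simp: add_pos_nonneg)
    have D: "D = {0..}" using False by (simp add: laplace_domain_def)
    have "s \<in> interior D" using s0 by (simp add: D interior_real_atLeast)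
    moreover have "(\<psi> has_real_derivative 1 / x) (at s)"
    proof -
      have "(\<psi> has_real_derivative h * (\<nu> * s powr (\<nu> - 1) / l / (1 + s powr \<nu> / l))) (at s)"
        unfolding \<psi> using p[of s] l s0 by (auto intro!: derivative_eq_intros simp: mult_ac)
      moreover have "1 + s powr \<nu> / l = (l + s powr \<nu>) / l" using l by (simp add: field_simps)
      ultimately show ?thesis using l by (simp add: x_eq[symmetric])
    qed
    moreover have "dual_rate D \<psi> x = ereal (x * \<psi> s - s)"
    proof (rule attained)
      show "s \<in> D" using s0 by (simp add: D)
      fix u assume "u \<in> D"
      then have u: "0 \<le> u" by (simp add: D)
      have "h * ln (1 + u powr \<nu> / l)
          \<le> h * (ln (1 + s powr \<nu> / l) + (1 + u powr \<nu> / l - (1 + s powr \<nu> / l)) / (1 + s powr \<nu> / l))"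
        using h p by (intro mult_left_mono ln_tangent) auto
      also have "(1 + u powr \<nu> / l - (1 + s powr \<nu> / l)) / (1 + s powr \<nu> / l) = (u powr \<nu> - s powr \<nu>) / (l + s powr \<nu>)"
      proof -
        have "1 + u powr \<nu> / l - (1 + s powr \<nu> / l) = (u powr \<nu> - s powr \<nu>) / l"
          "1 + s powr \<nu> / l = (l + s powr \<nu>) / l"
          using l by (auto simp: field_simps)
        then show ?thesis using l by simp
      qed
      also have "h * (ln (1 + s powr \<nu> / l) + (u powr \<nu> - s powr \<nu>) / (l + s powr \<nu>))
          \<le> h * (ln (1 + s powr \<nu> / l) + \<nu> * s powr (\<nu> - 1) * (u - s) / (l + s powr \<nu>))"
        using h p(2)[of s] powr_tangent[OF s0 u]
        by (intro mult_left_mono add_left_mono divide_right_mono) auto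
      also have "\<dots> = h * ln (1 + s powr \<nu> / l) + h * (\<nu> * s powr (\<nu> - 1) / (l + s powr \<nu>)) * (u - s)"
        by (simp add: distrib_left)
      finally show "\<psi> u \<le> \<psi> s + (u - s) / x"
        unfolding \<psi> x_eq by simp
    qed
    ultimately show thesis using that False s0 s(2) by simp
  qed
qed


section \<open>Shape and limits of the rate function\<close>

lemma laplace_exponent_sign:
  assumes "s \<in> D"
  shows "0 \<le> s \<Longrightarrow> 0 \<le> \<psi> s" "s \<le> 0 \<Longrightarrow> \<psi> s \<le> 0"
proof -
  show "0 \<le> \<psi> s" if "0 \<le> s"
    using that h l by (auto simp: laplace_exponent_def intro!: mult_nonneg_nonneg ln_ge_zero)
  show "\<psi> s \<le> 0" if "s \<le> 0"
  proof (cases "\<nu> = 1")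
    case True
    then have "ln (1 + s / l) \<le> 0"
      using assms that l by (subst ln_le_zero_iff) (auto simp: laplace_domain_def field_simps)
    then show ?thesis using h by (simp add: laplace_exponent_one[OF True] mult_nonneg_nonpos)
  next
    case False
    then have "s = 0" using that assms by (simp add: laplace_domain_def)
    then show ?thesis using False by (simp add: laplace_exponent_def)
  qed
qed

lemma laplace_exponent_at_one: "0 < \<psi> 1"
  using h l by (auto simp: laplace_exponent_def intro!: mult_pos_pos ln_gt_zero)

lemma dual_rate_one:
  assumes "\<nu> = 1"
  shows "dual_rate D \<psi> x = (if x \<ge> 0 then ereal (h * x * ln (h * x / l) - h * x + l) else \<infinity>)"
proof -
  \<comment> \<open>At \<open>x = 0\<close> the factor \<open>x\<close> annihilates the logarithm,
    in accordance with the convention 0 log 0 = 0.\<close>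
  consider "x < 0" | "x = 0" | "0 < x" by linarith
  then show ?thesis
  proof cases
    case 3
    have "1 + (h * x - l) / l = h * x / l" using l by (simp add: field_simps)
    obtain s where s: "dual_rate D \<psi> x = ereal (x * \<psi> s - s)" "s = h * x - l"
      by (rule slope_attained[OF 3]) (use assms in blast)
    show ?thesis
      unfolding s laplace_exponent_one[OF assms] \<open>1 + (h * x - l) / l = h * x / l\<close>
      using 3 by (simp add: algebra_simps)
  qed (use dual_rate_zero assms in \<open>auto simp: dual_rate_def\<close>)
qed

text \<open>For \<nu> < 1 the maximiser is at most \<open>h * \<nu> * x\<close> and
  \<open>\<psi>\<close> is increasing, so the rate lies between 0 and
  \<open>x * \<psi> (h * \<nu> * x)\<close>.\<close>

lemma dual_rate_tendsto_zero: "(dual_rate D \<psi> \<longlongrightarrow> dual_rate D \<psi> 0) (at_right 0)"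
proof (cases "\<nu> = 1")
  case True
  have "((\<lambda>x. h * x * ln (h * x / l) - h * x + l) \<longlongrightarrow> l) (at_right 0)"
    using h l by real_asymp
  then have "((\<lambda>x. ereal (h * x * ln (h * x / l) - h * x + l)) \<longlongrightarrow> ereal l) (at_right 0)"
    by simp
  moreover have "\<forall>\<^sub>F x in at_right 0. ereal (h * x * ln (h * x / l) - h * x + l) = dual_rate D \<psi> x"
    using eventually_at_right_less[of 0] by eventually_elim (simp add: dual_rate_one[OF True])
  ultimately have "(dual_rate D \<psi> \<longlongrightarrow> ereal l) (at_right 0)"
    by (rule Lim_transform_eventually)
  then show ?thesis
    unfolding dual_rate_zero using True by simp
next
  case False
  then have \<nu>1: "\<nu> < 1" using \<nu> by simp
  have "((\<lambda>x. x * (h * ln (1 + (h * \<nu> * x) powr \<nu> / l))) \<longlongrightarrow> 0) (at_right 0)"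
    using h l \<nu> by real_asymp
  then have lim: "((\<lambda>x. ereal (x * (h * ln (1 + (h * \<nu> * x) powr \<nu> / l)))) \<longlongrightarrow> 0) (at_right 0)"
    by (simp add: zero_ereal_def)
  have upper: "dual_rate D \<psi> x \<le> ereal (x * (h * ln (1 + (h * \<nu> * x) powr \<nu> / l)))" if x: "0 < x" for x
  proof -
    obtain s where s: "dual_rate D \<psi> x = ereal (x * \<psi> s - s)" "0 < s" "s \<le> h * \<nu> * x"
      by (rule slope_attained[OF x]) (use \<nu>1 in blast)
    have "\<psi> s \<le> h * ln (1 + (h * \<nu> * x) powr \<nu> / l)"
      unfolding laplace_exponent_less_one[OF \<nu>1] using h l s(2,3) \<nu>
      by (intro mult_left_mono iffD2[OF ln_le_cancel_iff] add_left_mono divide_right_mono powr_mono2)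
         (auto simp: add_pos_nonneg)
    then have "x * \<psi> s \<le> x * (h * ln (1 + (h * \<nu> * x) powr \<nu> / l))"
      using x by (intro mult_left_mono) auto
    then show ?thesis using s(1,2) by simp
  qed
  have lower: "0 \<le> dual_rate D \<psi> x" if "0 < x" for x
    using dual_rate_ge[of x 0 D \<psi>] that zero_mem_domain False
    by (simp add: laplace_exponent_def zero_ereal_def)
  have "(dual_rate D \<psi> \<longlongrightarrow> 0) (at_right 0)"
    using lim
    by (rule tendsto_sandwich[rotated 3, where f = "\<lambda>_. 0"])
       (auto intro!: eventually_mono[OF eventually_at_right_less] lower upper)
  then show ?thesis using dual_rate_zero False by simp
qed

text \<open>The maximiser \<open>s\<close> for \<open>x > 0\<close> is positive and has
  \<open>\<psi> s > 0\<close>, so using it at \<open>y > x\<close> already gives a larger value.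
  From 0 one passes through the point \<open>y / 2\<close>.\<close>

lemma strict_mono_dual_rate:
  assumes "\<nu> < 1"
  shows "strict_mono_on {0..} (dual_rate D \<psi>)"
proof (rule strict_mono_onI)
  have pos: "dual_rate D \<psi> x < dual_rate D \<psi> y" if "0 < x" "x < y" for x y
  proof -
    obtain s where s: "dual_rate D \<psi> x = ereal (x * \<psi> s - s)" "0 < s"
      by (rule slope_attained[OF \<open>0 < x\<close>]) (use assms in blast)
    have "0 < \<psi> s"
      using s(2) h l by (auto simp: laplace_exponent_less_one[OF assms] intro!: mult_pos_pos ln_gt_zero)
    then have "ereal (x * \<psi> s - s) < ereal (y * \<psi> s - s)" using that by simp
    also have "\<dots> \<le> dual_rate D \<psi> y"
      using s(2) that assms by (intro dual_rate_ge) (auto simp: laplace_domain_def)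
    finally show ?thesis using s(1) by simp
  qed
  fix x y :: real assume xy: "x \<in> {0..}" "y \<in> {0..}" "x < y"
  show "dual_rate D \<psi> x < dual_rate D \<psi> y"
  proof (cases "x = 0")
    case True
    have "0 \<le> dual_rate D \<psi> (y / 2)"
      using dual_rate_ge[of "y / 2" 0 D \<psi>] xy zero_mem_domain assms
      by (simp add: laplace_exponent_def zero_ereal_def)
    also have "\<dots> < dual_rate D \<psi> y" using True xy by (intro pos) auto
    finally show ?thesis using True dual_rate_zero assms by simp
  qed (use pos xy in auto)
qed

lemma dual_rate_tendsto_infinity: "(dual_rate D \<psi> \<longlongrightarrow> \<infinity>) at_top"
  unfolding tendsto_PInfty
proof
  fix r :: real
  show "\<forall>\<^sub>F x in at_top. ereal r < dual_rate D \<psi> x"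
    using eventually_gt_at_top[of 0] eventually_gt_at_top[of "(r + 1) / \<psi> 1"]
  proof eventually_elim
    case (elim x)
    have "ereal r < ereal (x * \<psi> 1 - 1)"
      using elim laplace_exponent_at_one by (simp add: field_simps)
    also have "\<dots> \<le> dual_rate D \<psi> x"
      using elim l by (intro dual_rate_ge) (auto simp: laplace_domain_def)
    finally show ?case .
  qed
qed

lemma renewal_ldp_waiting_density:
  assumes M: "prob_space M" and T: "prob_space.indep_vars M (\<lambda>_. borel) T {1..}"
    and X: "\<And>n. n \<ge> 1 \<Longrightarrow> has_real_density M (T n) (waiting_density \<nu> h l)"
  shows "renewal_ldp M T D \<psi> (if \<nu> = 1 then l / h else 0)"
proof -
  interpret prob_space M by (rule M)
  show ?thesis
  proof
    show "indep_vars (\<lambda>_. borel) T {1..}" by (rule T)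
    show "AE \<omega> in M. 0 < T n \<omega>" if "1 \<le> n" for n
      by (rule AE_pos_if_waiting_density[OF X[OF that]])
    show "(\<integral>\<^sup>+\<omega>. ennreal (exp (- (s * T n \<omega>))) \<partial>M) = ennreal (exp (- \<psi> s))" if "1 \<le> n" "s \<in> D" for n s
      by (rule laplace_waiting_density[OF M X[OF that(1)] that(2)])
    show "\<exists>s\<in>D. 0 \<le> s \<and> 0 < \<psi> s"
      using laplace_exponent_at_one l by (intro bexI[of _ 1]) (auto simp: laplace_domain_def)
    show "(if \<nu> = 1 then l / h else 0) * \<psi> s \<le> s" if s: "s \<in> D" for s
    proof (cases "\<nu> = 1")
      case True
      \<comment> \<open>The Gamma law has mean \<open>h / l\<close>, and the centre inequality for
        \<open>l / h\<close> becomes \<open>ln (1 + y) \<le> y\<close>.\<close>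
      have "0 < 1 + s / l" using s l True by (simp add: laplace_domain_def field_simps)
      then have "ln (1 + s / l) \<le> s / l" using ln_le_minus_one[of "1 + s / l"] by simp
      then show ?thesis
        unfolding laplace_exponent_one[OF True] using True h l by (simp add: pos_le_divide_eq mult.commute)
    qed (use s in \<open>simp add: laplace_domain_def\<close>)
    show "\<exists>s\<in>interior D. (\<psi> has_real_derivative 1 / x) (at s)" if "0 < x" for x
      by (rule slope_attained[OF that]) blast
    show "0 \<le> (if \<nu> = 1 then l / h else 0)" using h l by simp
  qed (fact zero_mem_domain laplace_exponent_sign dual_rate_tendsto_zero)+
qed

end

theorem proposition3p2:
  fixes M :: "'a measure" and T :: "nat \<Rightarrow> 'a \<Rightarrow> real" and \<nu> h l :: real
  assumes "prob_space M"
    and "0 < \<nu>" and "\<nu> \<le> 1" and "0 < h" and "0 < l"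
    and "prob_space.indep_vars M (\<lambda>_. borel) T {1..}"
    and "\<And>n. n \<ge> 1 \<Longrightarrow> has_real_density M (T n) (waiting_density \<nu> h l)"
  shows "let I = renewal_rate \<nu> l (cramer_rate M (T 1)) in
    satisfies_LDP M (\<lambda>t \<omega>. enn2real (renewal_count T t \<omega>) / t) I \<and>
    good_rate I \<and>
    (\<nu> = 1 \<longrightarrow>
      (\<forall>x. I x = (if x \<ge> 0 then ereal (h * x * ln (h * x / l) - h * x + l) else \<infinity>))) \<and>
    (\<nu> < 1 \<longrightarrow>
      (\<forall>x<0. I x = \<infinity>) \<and>
      strict_mono_on {0..} I \<and>
      (I \<longlongrightarrow> 0) (at_right 0) \<and> I 0 = 0 \<and>
      (I \<longlongrightarrow> \<infinity>) at_top)"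
proof -
  let ?I = "dual_rate (laplace_domain \<nu> l) (laplace_exponent \<nu> h l)"
  note params = assms(2-5)
  interpret renewal_ldp M T "laplace_domain \<nu> l" "laplace_exponent \<nu> h l" "if \<nu> = 1 then l / h else 0"
    by (rule renewal_ldp_waiting_density[OF params assms(1,6,7)])
  have eq: "renewal_rate \<nu> l (cramer_rate M (T 1)) = ?I"
    by (rule renewal_rate_eq_dual_rate[OF params assms(1) assms(7)[OF order_refl]])
  show ?thesis
    unfolding Let_def eq
  proof (intro conjI impI allI)
    show "satisfies_LDP M (\<lambda>t \<omega>. enn2real (renewal_count T t \<omega>) / t) ?I" by (rule LDP)
    show "good_rate ?I" by (rule good_rate_I)
    show "?I x = (if x \<ge> 0 then ereal (h * x * ln (h * x / l) - h * x + l) else \<infinity>)" if "\<nu> = 1" for x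
      by (rule dual_rate_one[OF params that])
    show "?I x = \<infinity>" if "x < 0" for x
      using that by (simp add: dual_rate_def)
    assume \<nu>: "\<nu> < 1"
    show "strict_mono_on {0..} ?I" by (rule strict_mono_dual_rate[OF params \<nu>])
    show zero: "?I 0 = 0" using dual_rate_zero[OF params] \<nu> by simp
    show "(?I \<longlongrightarrow> 0) (at_right 0)" using dual_rate_tendsto_zero[OF params] zero by simp
    show "(?I \<longlongrightarrow> \<infinity>) at_top" by (rule dual_rate_tendsto_infinity[OF params])
  qed
qed

end
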